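(* For any prime $p$, the group $$\Lambda_p=\langle a,s,t \mid a^p,\ [s,t],\ [a^t,a],\ a^s=a^ta\rangle$$ embeds as a cocompact lattice (i.e. is isomorphic to a discrete cocompact subgroup) in the locally compact group $\mathrm{SOL}_5(\mathbf{F}_p(\!(u)\!))$.
   Context: Here $a^t$ denotes the conjugate of $a$ by $t$ and $[x,y]$ the commutator. $\mathbf{F}_p(\!(u)\!)$ is the local field of Laurent series over the finite field $\mathbf{F}_p$. For a local field $\mathbf{K}$ and $d\ge 1$, $\mathrm{SOL}_{2d-1}(\mathbf{K})$ denotes the semidirect product $\mathbf{K}^d\rtimes D$, where $D$ is the group of invertible $d\times d$ diagonal matrices over $\mathbf{K}$ with determinant of norm one, acting on $\mathbf{K}^d$ in the natural way. Thus $\mathrm{SOL}_5(\mathbf{K})$ corresponds to $d=3$. *)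

theory Defs
  imports
    "HOL-Analysis.Analysis"
    "HOL-Algebra.Coset"
    "HOL-Computational_Algebra.Formal_Laurent_Series"
    "Berlekamp_Zassenhaus.Finite_Field"
begin

unbundle no fps_syntax

section \<open>Group presentations\<close>

text \<open>
  A letter \<open>(x, True)\<close> stands for the generator \<open>x\<close> and \<open>(x, False)\<close> for its formal inverse.
  Elements of the free group are the reduced words; multiplication is concatenation followed by
  free reduction.
\<close>

type_synonym 'x letter = "'x \<times> bool"

definition inv_letter :: "'x letter \<Rightarrow> 'x letter" where
  "inv_letter l = (fst l, \<not> snd l)"

fun free_reduced :: "'x letter list \<Rightarrow> bool" where
  "free_reduced (k # l # w) \<longleftrightarrow> l \<noteq> inv_letter k \<and> free_reduced (l # w)"
| "free_reduced _ \<longleftrightarrow> True"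

fun push_letter :: "'x letter \<Rightarrow> 'x letter list \<Rightarrow> 'x letter list" where
  "push_letter k [] = [k]"
| "push_letter k (l # w) = (if l = inv_letter k then w else k # l # w)"

definition free_reduce :: "'x letter list \<Rightarrow> 'x letter list" where
  "free_reduce w = foldr push_letter w []"

definition free_group :: "'x letter list monoid" where
  "free_group = \<lparr>carrier = {w. free_reduced w}, mult = (\<lambda>v w. free_reduce (v @ w)), one = []\<rparr>"

definition free_gen :: "'x \<Rightarrow> 'x letter list" where
  "free_gen x = [(x, True)]"

definition normal_closure :: "('a, 'b) monoid_scheme \<Rightarrow> 'a set \<Rightarrow> 'a set" where
  "normal_closure G R = \<Inter>{N. N \<lhd> G \<and> R \<subseteq> N}"

definition presented_group :: "'x letter list set \<Rightarrow> 'x letter list set monoid" where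
  "presented_group R = free_group Mod normal_closure free_group R"

definition conj_elt :: "('a, 'b) monoid_scheme \<Rightarrow> 'a \<Rightarrow> 'a \<Rightarrow> 'a" where
  "conj_elt G x y = inv\<^bsub>G\<^esub> y \<otimes>\<^bsub>G\<^esub> x \<otimes>\<^bsub>G\<^esub> y"

definition comm_elt :: "('a, 'b) monoid_scheme \<Rightarrow> 'a \<Rightarrow> 'a \<Rightarrow> 'a" where
  "comm_elt G x y = inv\<^bsub>G\<^esub> x \<otimes>\<^bsub>G\<^esub> inv\<^bsub>G\<^esub> y \<otimes>\<^bsub>G\<^esub> x \<otimes>\<^bsub>G\<^esub> y"

datatype gen = Gen_a | Gen_s | Gen_t

definition Lambda_relators :: "nat \<Rightarrow> gen letter list set" where
  "Lambda_relators p =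
    (let F = free_group; a = free_gen Gen_a; s = free_gen Gen_s; t = free_gen Gen_t in
     {a [^]\<^bsub>F\<^esub> p,
      comm_elt F s t,
      comm_elt F (conj_elt F a t) a,
      conj_elt F a s \<otimes>\<^bsub>F\<^esub> inv\<^bsub>F\<^esub> (conj_elt F a t \<otimes>\<^bsub>F\<^esub> a)})"

definition Lambda :: "nat \<Rightarrow> gen letter list set monoid" where
  "Lambda p = presented_group (Lambda_relators p)"


subsection \<open>The free group is a group\<close>

lemma inv_letter_simps [simp]:
  "inv_letter (inv_letter l) = l" "inv_letter l \<noteq> l" "l \<noteq> inv_letter l"
  by (auto simp: inv_letter_def prod_eq_iff)

lemma reduced_tl: "free_reduced (l # w) \<Longrightarrow> free_reduced w"
  by (cases w) auto

lemma reduced_push_letter: "free_reduced w \<Longrightarrow> free_reduced (push_letter k w)"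
  by (cases w) (auto dest: reduced_tl)

lemma reduced_foldr_push: "free_reduced w \<Longrightarrow> free_reduced (foldr push_letter v w)"
  by (induction v) (auto intro: reduced_push_letter)

lemma push_letter_Cons_reduced: "free_reduced (k # w) \<Longrightarrow> push_letter k w = k # w"
  by (cases w) auto

lemma free_reduce_reduced: "free_reduced w \<Longrightarrow> free_reduce w = w"
proof (induction w)
  case (Cons k w)
  then show ?case
    using reduced_tl[OF Cons.prems] push_letter_Cons_reduced[OF Cons.prems]
    by (simp add: free_reduce_def)
qed (simp add: free_reduce_def)

lemma push_letter_inv: "free_reduced w \<Longrightarrow> push_letter k (push_letter (inv_letter k) w) = w"
  by (cases w) (auto simp: push_letter_Cons_reduced)

lemma foldr_push_push:
  assumes "free_reduced w"
  shows "foldr push_letter (push_letter k v) w = push_letter k (foldr push_letter v w)"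
  using assms by (cases v) (auto simp: push_letter_inv reduced_foldr_push)

lemma foldr_push_reduce:
  assumes "free_reduced w"
  shows "foldr push_letter (free_reduce v) w = foldr push_letter v w"
  unfolding free_reduce_def by (induction v) (auto simp: foldr_push_push assms)

lemma reduced_free_reduce: "free_reduced (free_reduce w)"
  by (simp add: free_reduce_def reduced_foldr_push)

lemma free_reduce_append: "free_reduce (v @ w) = foldr push_letter v (free_reduce w)"
  by (simp add: free_reduce_def)

lemma free_group_left_inverse: "free_reduce (rev (map inv_letter w) @ w) = []"
proof (induction w)
  case Nil
  show ?case by (simp add: free_reduce_def)
next
  case (Cons k w)
  have "free_reduce (inv_letter k # k # w) = free_reduce w"
    using push_letter_inv[of "free_reduce w" "inv_letter k"] reduced_free_reduce[of w]
    by (simp add: free_reduce_def)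
  then show ?case
    using Cons by (simp add: free_reduce_append)
qed

lemma free_reduce_left: "free_reduce (free_reduce v @ w) = free_reduce (v @ w)"
  by (simp only: free_reduce_append foldr_push_reduce[OF reduced_free_reduce])

lemma free_reduce_right: "free_reduce (v @ free_reduce w) = free_reduce (v @ w)"
  by (simp only: free_reduce_append free_reduce_reduced[OF reduced_free_reduce])

lemma group_free_group: "group free_group"
proof (rule groupI, goal_cases)
  case (5 w)
  have "free_reduce (free_reduce (rev (map inv_letter w)) @ w) = []"
    by (simp only: free_reduce_left free_group_left_inverse)
  then show ?case
    using reduced_free_reduce[of "rev (map inv_letter w)"]
    by (simp add: free_group_def) blast
qed (simp_all add: free_group_def reduced_free_reduce free_reduce_reduced
       free_reduce_left free_reduce_right)


section \<open>Discrete cocompact subgroups\<close>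

definition quotient_topology :: "'a topology \<Rightarrow> ('a \<Rightarrow> 'b) \<Rightarrow> 'b topology" where
  "quotient_topology X f =
    topology (\<lambda>U. U \<subseteq> f ` topspace X \<and> openin X {x \<in> topspace X. f x \<in> U})"

lemma openin_quotient_topology:
  "openin (quotient_topology X f) U \<longleftrightarrow>
    U \<subseteq> f ` topspace X \<and> openin X {x \<in> topspace X. f x \<in> U}"
proof -
  have "openin X {x \<in> topspace X. f x \<in> S \<inter> T}"
    if "openin X {x \<in> topspace X. f x \<in> S}" "openin X {x \<in> topspace X. f x \<in> T}" for S T
  proof -
    have "{x \<in> topspace X. f x \<in> S \<inter> T} =
      {x \<in> topspace X. f x \<in> S} \<inter> {x \<in> topspace X. f x \<in> T}" by blast
    then show ?thesis using openin_Int[OF that] by simp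
  qed
  moreover have "openin X {x \<in> topspace X. f x \<in> \<Union>K}"
    if "\<And>S. S \<in> K \<Longrightarrow> openin X {x \<in> topspace X. f x \<in> S}" for K
  proof -
    have "{x \<in> topspace X. f x \<in> \<Union>K} = (\<Union>S\<in>K. {x \<in> topspace X. f x \<in> S})" by blast
    moreover have "openin X (\<Union>S\<in>K. {x \<in> topspace X. f x \<in> S})"
      by (rule openin_Union) (use that in blast)
    ultimately show ?thesis by simp
  qed
  ultimately have "istopology (\<lambda>U. U \<subseteq> f ` topspace X \<and> openin X {x \<in> topspace X. f x \<in> U})"
    unfolding istopology_def by blast
  then show ?thesis
    by (simp add: quotient_topology_def)
qed

lemma quotient_map_quotient_topology: "quotient_map X (quotient_topology X f) f"
proof -
  have "{x \<in> topspace X. f x \<in> f ` topspace X} = topspace X" by blast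
  then have "openin (quotient_topology X f) (f ` topspace X)"
    by (simp add: openin_quotient_topology)
  then have "topspace (quotient_topology X f) = f ` topspace X"
    by (meson openin_quotient_topology openin_subset openin_topspace subset_antisym)
  then show ?thesis
    by (simp add: quotient_map_def openin_quotient_topology)
qed

text \<open>A discrete subgroup with compact quotient \<open>G/H\<close>; \<open>X\<close> is the topology of \<open>G\<close>.\<close>

definition cocompact_lattice :: "('a, 'b) monoid_scheme \<Rightarrow> 'a topology \<Rightarrow> 'a set \<Rightarrow> bool" where
  "cocompact_lattice G X H \<longleftrightarrow>
    subgroup H G \<and>
    subtopology X H = discrete_topology H \<and>
    compact_space (quotient_topology X (\<lambda>g. g <#\<^bsub>G\<^esub> H))"


section \<open>The groups SOL\<close>

text \<open>
  The absolute value \<open>nrm\<close> of the field is an explicit parameter.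
  With \<open>d = CARD('d)\<close>, the group below is the one written with index \<open>2 * d - 1\<close>.
\<close>

definition norm_one_diag :: "('k::field \<Rightarrow> real) \<Rightarrow> ('k^'d^'d) set" where
  "norm_one_diag nrm = {A. (\<forall>i j. i \<noteq> j \<longrightarrow> A $ i $ j = 0) \<and> invertible A \<and> nrm (det A) = 1}"

definition SOL :: "('k::field \<Rightarrow> real) \<Rightarrow> (('k^'d) \<times> ('k^'d^'d)) monoid" where
  "SOL nrm = \<lparr>carrier = UNIV \<times> norm_one_diag nrm,
              mult = (\<lambda>(v, A) (w, B). (v + A *v w, A ** B)),
              one = (0, mat 1)\<rparr>"

text \<open>
  On matrices whose determinant has norm one inversion is continuous, so the topology induced from
  the space of all matrices is the group topology of the diagonal factor.
\<close>

definition SOL_topology ::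
  "('k::{field, topological_space} \<Rightarrow> real) \<Rightarrow> (('k^'d) \<times> ('k^'d^'d)) topology" where
  "SOL_topology nrm = top_of_set (carrier (SOL nrm))"

text \<open>
  The normalised absolute value on Laurent series over a finite field. The library's metric on
  \<^typ>\<open>'a fls\<close> uses base 2 instead of the field size, which gives the same topology.
\<close>

definition fls_abs :: "'a::{zero, finite} fls \<Rightarrow> real" where
  "fls_abs f = (if f = 0 then 0 else of_nat CARD('a) powi (- fls_subdegree f))"

lemma fls_abs_mult:
  fixes f g :: "'a::{field, finite} fls"
  shows "fls_abs (f * g) = fls_abs f * fls_abs g"
proof (cases "f = 0 \<or> g = 0")
  case False
  then have "fls_subdegree (f * g) = fls_subdegree f + fls_subdegree g" by simp
  with False show ?thesis
    by (simp add: fls_abs_def flip: power_int_add)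
qed (auto simp: fls_abs_def)

lemma fls_abs_1 [simp]: "fls_abs (1 :: 'a::{field, finite} fls) = 1"
  by (simp add: fls_abs_def)

lemma norm_one_diag_mult:
  fixes A B :: "'a::{field, finite} fls ^ 'd ^ 'd"
  assumes "A \<in> norm_one_diag fls_abs" "B \<in> norm_one_diag fls_abs"
  shows "A ** B \<in> norm_one_diag fls_abs"
proof -
  have "(A ** B) $ i $ j = 0" if "i \<noteq> j" for i j
  proof -
    have "A $ i $ k * B $ k $ j = 0" for k
      using assms that by (cases "i = k") (auto simp: norm_one_diag_def)
    then show ?thesis
      unfolding matrix_matrix_mult_def vec_lambda_beta by (intro sum.neutral ballI)
  qed
  then show ?thesis
    using assms by (auto simp: norm_one_diag_def invertible_mult det_mul fls_abs_mult)
qed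

lemma norm_one_diag_inverse:
  fixes A :: "'a::{field, finite} fls ^ 'd ^ 'd"
  assumes A: "A \<in> norm_one_diag fls_abs"
  shows "\<exists>B \<in> norm_one_diag fls_abs. B ** A = mat 1"
proof -
  obtain B where B: "A ** B = mat 1" "B ** A = mat 1"
    using A by (auto simp: norm_one_diag_def invertible_def)
  have entries: "A $ i $ i * B $ i $ j = (if i = j then 1 else 0)" for i j
  proof -
    have "(A ** B) $ i $ j = (\<Sum>k\<in>{i}. A $ i $ k * B $ k $ j)"
      unfolding matrix_matrix_mult_def vec_lambda_beta
      by (rule sum.mono_neutral_right) (use A in \<open>auto simp: norm_one_diag_def\<close>)
    then show ?thesis by (simp add: B(1) mat_def)
  qed
  have "B $ i $ j = 0" if "i \<noteq> j" for i j
    using entries[of i j] entries[of i i] that by auto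
  moreover have "fls_abs (det B) = 1"
  proof -
    have "det A * det B = 1" using B(1) by (metis det_I det_mul)
    then have "fls_abs (det A) * fls_abs (det B) = 1" by (metis fls_abs_1 fls_abs_mult)
    then show ?thesis using A by (simp add: norm_one_diag_def)
  qed
  moreover have "invertible B" using B by (auto simp: invertible_def)
  ultimately show ?thesis using B(2) by (auto simp: norm_one_diag_def)
qed

lemma group_SOL:
  "group (SOL fls_abs :: (('a::{field, finite} fls ^ 'd) \<times> ('a fls ^ 'd ^ 'd)) monoid)"
proof (rule groupI, goal_cases)
  case 2
  have "(mat 1 :: 'a fls ^ 'd ^ 'd) \<in> norm_one_diag fls_abs"
    using invertible_def[of "mat 1 :: 'a fls ^ 'd ^ 'd"]
    by (auto simp: norm_one_diag_def) (simp add: mat_def)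
  then show ?case by (simp add: SOL_def)
next
  case (5 x)
  obtain v A where x: "x = (v, A)" by (cases x)
  with 5 have "A \<in> norm_one_diag fls_abs" by (simp add: SOL_def)
  then obtain B where B: "B \<in> norm_one_diag fls_abs" "B ** A = mat 1"
    using norm_one_diag_inverse by blast
  show ?case
  proof (rule bexI)
    show "(- (B *v v), B) \<otimes>\<^bsub>SOL fls_abs\<^esub> x = \<one>\<^bsub>SOL fls_abs\<^esub>"
      by (simp add: SOL_def x B)
    show "(- (B *v v), B) \<in> carrier (SOL fls_abs)"
      by (simp add: SOL_def B)
  qed
qed (auto simp: SOL_def norm_one_diag_mult matrix_vector_right_distrib
       matrix_vector_mul_assoc matrix_mul_assoc add.assoc)

end

theory Submission
  imports Defs
begin

unbundle no Formal_Power_Series.fps_syntax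

text \<open>
  Completing \<open>F\<^sub>p(X)\<close> at its places \<open>0\<close>, \<open>-1\<close> and \<open>\<infinity>\<close> embeds the ring
  \<open>F\<^sub>p[X, 1/X, 1/(X + 1)]\<close> as a discrete cocompact subgroup of the sum of three copies of the Laurent
  series field, and its units \<open>X\<close>, \<open>X + 1\<close> generate a lattice in the group of diagonal matrices of
  determinant of norm one, by the product formula. In the presented group the relation
  \<open>a\<^sup>s = a\<^sup>t a\<close>, together with the commutation of \<open>s\<close> and \<open>t\<close>, propagates the single relation
  \<open>[a\<^sup>t, a] = 1\<close> to all conjugates of \<open>a\<close>. Hence, after conjugation by some \<open>s\<^sup>m t\<^sup>n\<close>, every element
  is a polynomial in the action of \<open>t\<close> applied to \<open>a\<close>, times some \<open>s\<^sup>i t\<^sup>j\<close>; this normal form gives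
  both the injectivity of the map to SOL and the shape of its image.
\<close>

section \<open>Words, presentations and the normal form\<close>

fun eval_word :: "('a, 'b) monoid_scheme \<Rightarrow> ('x \<Rightarrow> 'a) \<Rightarrow> 'x letter list \<Rightarrow> 'a" where
  "eval_word G f [] = \<one>\<^bsub>G\<^esub>"
| "eval_word G f (l # w) =
    (if snd l then f (fst l) else inv\<^bsub>G\<^esub> f (fst l)) \<otimes>\<^bsub>G\<^esub> eval_word G f w"

context group
begin

lemma eval_word_closed [simp, intro]:
  assumes "range f \<subseteq> carrier G"
  shows "eval_word G f w \<in> carrier G"
  using assms by (induction w) (auto simp: image_subset_iff)

lemma eval_word_push_letter:
  assumes f: "range f \<subseteq> carrier G"
  shows "eval_word G f (push_letter k w) = eval_word G f (k # w)"
proof (cases w)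
  case (Cons l v)
  have "f x \<in> carrier G" for x using f by auto
  with eval_word_closed[OF f, of v] show ?thesis
    unfolding Cons by (auto simp: inv_letter_def m_assoc[symmetric])
qed auto

lemma eval_word_free_reduce:
  assumes "range f \<subseteq> carrier G"
  shows "eval_word G f (free_reduce w) = eval_word G f w"
  by (induction w) (simp_all add: free_reduce_def eval_word_push_letter[OF assms])

lemma eval_word_append:
  assumes f: "range f \<subseteq> carrier G"
  shows "eval_word G f (v @ w) = eval_word G f v \<otimes> eval_word G f w"
proof (induction v)
  case (Cons l v)
  have "f x \<in> carrier G" for x using f by auto
  with Cons f show ?case by (simp add: m_assoc)
qed (use f in auto)

lemma eval_word_hom:
  assumes "range f \<subseteq> carrier G"
  shows "eval_word G f \<in> hom free_group G"
  using assms
  by (intro homI) (auto simp: free_group_def eval_word_free_reduce eval_word_append)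

lemma eval_word_free_gen [simp]:
  assumes "range f \<subseteq> carrier G"
  shows "eval_word G f (free_gen x) = f x"
proof -
  have "f x \<in> carrier G" using assms by auto
  then show ?thesis by (simp add: free_gen_def)
qed

end

lemma free_gen_closed [simp, intro]: "free_gen x \<in> carrier free_group"
  by (simp add: free_gen_def free_group_def)

lemma free_group_eval_word:
  assumes "w \<in> carrier free_group"
  shows "eval_word free_group free_gen w = w"
proof -
  interpret F: group free_group by (rule group_free_group)
  have inv: "inv\<^bsub>free_group\<^esub> (free_gen x) = [(x, False)]" for x
    by (rule F.inv_equality) (simp_all add: free_gen_def free_group_def free_reduce_def inv_letter_def)
  have "free_reduced w \<Longrightarrow> eval_word free_group free_gen w = w"
  proof (induction w)
    case (Cons l w)
    then have "eval_word free_group free_gen w = w" using reduced_tl by blast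
    then have "eval_word free_group free_gen (l # w) = [l] \<otimes>\<^bsub>free_group\<^esub> w"
      by (cases l) (simp add: inv, simp add: free_gen_def)
    also have "\<dots> = l # w" using Cons.prems by (simp add: free_group_def free_reduce_reduced)
    finally show ?case .
  qed (simp add: free_group_def)
  with assms show ?thesis by (simp add: free_group_def)
qed

lemma hom_eval_word:
  assumes h: "group_hom G H h" and f: "range f \<subseteq> carrier G"
  shows "h (eval_word G f w) = eval_word H (h \<circ> f) w"
proof -
  interpret group_hom G H h by fact
  have "f x \<in> carrier G" for x using f by auto
  with f show ?thesis by (induction w) auto
qed

lemma (in group) normal_closure_normal:
  assumes "R \<subseteq> carrier G"
  shows "normal_closure G R \<lhd> G"
proof -
  have "carrier G \<lhd> G"
    using normal_inv_iff subgroup_self by auto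
  then have "carrier G \<in> {N. N \<lhd> G \<and> R \<subseteq> N}" using assms by simp
  then have ne: "{N. N \<lhd> G \<and> R \<subseteq> N} \<noteq> {}" by blast
  have "subgroup (normal_closure G R) G"
    unfolding normal_closure_def
    by (rule subgroups_Inter) (use ne normal_imp_subgroup in auto)
  then show ?thesis
    unfolding normal_inv_iff by (auto simp: normal_closure_def normal_inv_iff)
qed

lemma normal_closure_superset: "R \<subseteq> normal_closure G R"
  by (auto simp: normal_closure_def)

lemma normal_closure_minimal: "N \<lhd> G \<Longrightarrow> R \<subseteq> N \<Longrightarrow> normal_closure G R \<subseteq> N"
  by (auto simp: normal_closure_def)

lemma presented_group_iso_image:
  assumes "group G" and f: "range f \<subseteq> carrier G"
    and rel: "\<And>r. r \<in> R \<Longrightarrow> eval_word G f r = \<one>\<^bsub>G\<^esub>"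
    and R: "R \<subseteq> carrier free_group"
    and ker: "\<And>w. w \<in> carrier free_group \<Longrightarrow> eval_word G f w = \<one>\<^bsub>G\<^esub> \<Longrightarrow>
                 w \<in> normal_closure free_group R"
  shows "presented_group R \<cong> G\<lparr>carrier := eval_word G f ` carrier free_group\<rparr>"
proof -
  interpret G: group G by fact
  interpret F: group free_group by (rule group_free_group)
  let ?H = "G\<lparr>carrier := eval_word G f ` carrier free_group\<rparr>"
  interpret h: group_hom free_group G "eval_word G f"
    by unfold_locales (rule G.eval_word_hom[OF f])
  interpret H: group ?H
    by (rule G.subgroup_imp_group[OF h.img_is_subgroup])
  interpret h': group_hom free_group ?H "eval_word G f"
    by unfold_locales (auto simp: hom_def)
  have "kernel free_group G (eval_word G f) = normal_closure free_group R"
  proof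
    show "kernel free_group G (eval_word G f) \<subseteq> normal_closure free_group R"
      using ker by (auto simp: kernel_def)
    show "normal_closure free_group R \<subseteq> kernel free_group G (eval_word G f)"
      by (rule normal_closure_minimal[OF h.normal_kernel]) (use rel R in \<open>auto simp: kernel_def\<close>)
  qed
  moreover have "kernel free_group ?H (eval_word G f) = kernel free_group G (eval_word G f)"
    by (simp add: kernel_def)
  ultimately show ?thesis
    using h'.FactGroup_iso unfolding presented_group_def by simp
qed

context group
begin

lemma inv_mult_cancel [simp]:
  "g \<in> carrier G \<Longrightarrow> x \<in> carrier G \<Longrightarrow> inv g \<otimes> (g \<otimes> x) = x"
  "g \<in> carrier G \<Longrightarrow> x \<in> carrier G \<Longrightarrow> g \<otimes> (inv g \<otimes> x) = x"
  by (simp_all flip: m_assoc)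

lemma conj_elt_closed [simp, intro]:
  "x \<in> carrier G \<Longrightarrow> g \<in> carrier G \<Longrightarrow> conj_elt G x g \<in> carrier G"
  by (simp add: conj_elt_def)

lemma comm_elt_closed [simp, intro]:
  "x \<in> carrier G \<Longrightarrow> y \<in> carrier G \<Longrightarrow> comm_elt G x y \<in> carrier G"
  by (simp add: comm_elt_def)

lemma conj_elt_mult:
  "x \<in> carrier G \<Longrightarrow> y \<in> carrier G \<Longrightarrow> g \<in> carrier G \<Longrightarrow>
    conj_elt G (x \<otimes> y) g = conj_elt G x g \<otimes> conj_elt G y g"
  by (simp add: conj_elt_def m_assoc)

lemma conj_elt_conj_elt:
  "x \<in> carrier G \<Longrightarrow> g \<in> carrier G \<Longrightarrow> h \<in> carrier G \<Longrightarrow>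
    conj_elt G (conj_elt G x g) h = conj_elt G x (g \<otimes> h)"
  by (simp add: conj_elt_def m_assoc inv_mult_group)

lemma conj_elt_one [simp]: "g \<in> carrier G \<Longrightarrow> conj_elt G \<one> g = \<one>"
  by (simp add: conj_elt_def)

lemma conj_elt_by_one [simp]: "x \<in> carrier G \<Longrightarrow> conj_elt G x \<one> = x"
  by (simp add: conj_elt_def)

lemma conj_elt_hom: "g \<in> carrier G \<Longrightarrow> group_hom G G (\<lambda>x. conj_elt G x g)"
  by unfold_locales (auto simp: hom_def conj_elt_mult)

lemma conj_elt_inv:
  "x \<in> carrier G \<Longrightarrow> g \<in> carrier G \<Longrightarrow> conj_elt G (inv x) g = inv (conj_elt G x g)"
  using group_hom.hom_inv[OF conj_elt_hom] by simp

lemma conj_elt_int_pow: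
  "x \<in> carrier G \<Longrightarrow> g \<in> carrier G \<Longrightarrow> conj_elt G (x [^] (k::int)) g = conj_elt G x g [^] k"
  using group_hom.hom_int_pow[OF conj_elt_hom] by simp

lemma conj_elt_commute:
  assumes "x \<in> carrier G" "g \<in> carrier G" "x \<otimes> g = g \<otimes> x"
  shows "conj_elt G x g = x"
  using assms by (simp add: conj_elt_def m_assoc inv_solve_left')

lemma conj_elt_eq_one_iff:
  assumes "x \<in> carrier G" "g \<in> carrier G"
  shows "conj_elt G x g = \<one> \<longleftrightarrow> x = \<one>"
proof
  assume "conj_elt G x g = \<one>"
  then have "conj_elt G (conj_elt G x g) (inv g) = \<one>" using assms by simp
  then show "x = \<one>" using assms by (simp add: conj_elt_conj_elt)
qed (use assms in auto)

lemma comm_elt_eq_one_iff: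
  assumes "x \<in> carrier G" "y \<in> carrier G"
  shows "comm_elt G x y = \<one> \<longleftrightarrow> x \<otimes> y = y \<otimes> x"
proof -
  have "comm_elt G x y = inv (y \<otimes> x) \<otimes> (x \<otimes> y)"
    using assms by (simp add: comm_elt_def inv_mult_group m_assoc)
  moreover have "inv (y \<otimes> x) \<otimes> (x \<otimes> y) = \<one> \<longleftrightarrow> x \<otimes> y = (y \<otimes> x) \<otimes> \<one>"
    using assms inv_solve_left[of \<one> "y \<otimes> x" "x \<otimes> y"] by (simp add: eq_commute)
  ultimately show ?thesis using assms by simp
qed

lemma int_pow_commute:
  assumes "x \<in> carrier G" "y \<in> carrier G" "x \<otimes> y = y \<otimes> x"
  shows "x [^] (k::int) \<otimes> y = y \<otimes> x [^] k"
proof -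
  have "conj_elt G (x [^] k) y = x [^] k"
    using assms by (simp add: conj_elt_int_pow conj_elt_commute)
  then show ?thesis
    using assms by (metis conj_elt_def inv_closed inv_solve_left int_pow_closed m_assoc m_closed)
qed

end

primrec horner :: "('a, 'b) monoid_scheme \<Rightarrow> 'a \<Rightarrow> 'a \<Rightarrow> int list \<Rightarrow> 'a" where
  "horner G a t [] = \<one>\<^bsub>G\<^esub>"
| "horner G a t (c # cs) = a [^]\<^bsub>G\<^esub> c \<otimes>\<^bsub>G\<^esub> conj_elt G (horner G a t cs) t"

lemma hom_conj_elt:
  assumes "group_hom G H h" "x \<in> carrier G" "g \<in> carrier G"
  shows "h (conj_elt G x g) = conj_elt H (h x) (h g)"
proof -
  interpret group_hom G H h by fact
  show ?thesis using assms(2,3) by (simp add: conj_elt_def)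
qed

lemma (in group) horner_closed [simp, intro]:
  "a \<in> carrier G \<Longrightarrow> t \<in> carrier G \<Longrightarrow> horner G a t cs \<in> carrier G"
  by (induction cs) auto

lemma hom_horner:
  assumes "group_hom G H h" "a \<in> carrier G" "t \<in> carrier G"
  shows "h (horner G a t cs) = horner H (h a) (h t) cs"
proof -
  interpret group_hom G H h by fact
  show ?thesis
    using assms(2,3)
    by (induction cs) (simp_all add: hom_conj_elt[OF assms(1)] hom_int_pow)
qed

lemma (in group) horner_eq_one:
  assumes "a \<in> carrier G" "t \<in> carrier G" "a [^] n = \<one>" "\<forall>c\<in>set cs. int n dvd c"
  shows "horner G a t cs = \<one>"
  using assms(4)
proof (induction cs)
  case (Cons c cs)
  then obtain k where "c = int n * k" by auto
  then have "a [^] c = (a [^] int n) [^] k" using assms by (simp add: int_pow_pow)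
  also have "\<dots> = \<one>" using assms by (simp add: int_pow_int)
  finally show ?case using Cons assms by simp
qed simp

locale Lambda_group = group +
  fixes a s t :: 'a
  assumes gens_closed [simp, intro]: "a \<in> carrier G" "s \<in> carrier G" "t \<in> carrier G"
    and rel_st: "comm_elt G s t = \<one>"
    and rel_at: "comm_elt G (conj_elt G a t) a = \<one>"
    and rel_as: "conj_elt G a s \<otimes> inv (conj_elt G a t \<otimes> a) = \<one>"
begin

lemma st_commute: "s \<otimes> t = t \<otimes> s"
  using rel_st by (simp add: comm_elt_eq_one_iff)

lemma conj_s: "conj_elt G a s = conj_elt G a t \<otimes> a"
  using rel_as by (metis conj_elt_closed gens_closed inv_closed inv_equality inv_inv m_closed)

definition b :: "nat \<Rightarrow> 'a" where "b n = conj_elt G a (t [^] n)"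

lemma b_closed [simp, intro]: "b n \<in> carrier G"
  by (simp add: b_def)

lemma b_0 [simp]: "b 0 = a"
  by (simp add: b_def)

lemma conj_b: "conj_elt G (b n) (t [^] k) = b (n + k)"
  by (simp add: b_def conj_elt_conj_elt nat_pow_mult)

lemma b_1: "b (Suc 0) = conj_elt G a t"
  by (simp add: b_def)

lemma conj_s_b: "conj_elt G (b n) s = b (Suc n) \<otimes> b n"
proof -
  have "conj_elt G (b n) s = conj_elt G (conj_elt G a s) (t [^] n)"
    using group_commutes_pow[of t s n] st_commute by (simp add: b_def conj_elt_conj_elt)
  also have "\<dots> = b (Suc n) \<otimes> b n"
    using conj_b[of "Suc 0" n] conj_b[of 0 n] by (simp add: conj_s conj_elt_mult b_1)
  finally show ?thesis .
qed

text \<open>Conjugating \<open>[a, b n] = 1\<close> by \<open>s\<close> gives \<open>[b 1 a, b (n + 1) b n] = 1\<close>, in which all pairs but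
  \<open>a, b (n + 1)\<close> are already known to commute.\<close>

lemma a_b_commute: "a \<otimes> b n = b n \<otimes> a"
proof (induction n rule: less_induct)
  case (less m)
  consider "m = 0" | "m = 1" | n where "m = Suc n" "n \<ge> 1" by (cases m) force+
  then show ?case
  proof cases
    case 2
    then show ?thesis using rel_at by (simp add: comm_elt_eq_one_iff b_1)
  next
    case (3 n)
    have shift: "b 1 \<otimes> b (Suc k) = b (Suc k) \<otimes> b 1" if "k < m" for k
      using arg_cong[OF less[OF that], of "\<lambda>x. conj_elt G x t"] conj_b[of k 1]
      by (simp add: conj_elt_mult b_1)
    obtain l where l: "n = Suc l" using 3 by (cases n) auto
    have c1: "b 1 \<otimes> b m = b m \<otimes> b 1" using shift[of n] 3 by simp
    have c2: "b 1 \<otimes> b n = b n \<otimes> b 1" using shift[of l] 3 l by simp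
    have c3: "a \<otimes> b n = b n \<otimes> a" using less 3 by simp
    have "conj_elt G (a \<otimes> b n) s = conj_elt G (b n \<otimes> a) s" using c3 by simp
    then have "(b 1 \<otimes> a) \<otimes> (b m \<otimes> b n) = (b m \<otimes> b n) \<otimes> (b 1 \<otimes> a)"
      using 3 conj_s_b[of n] by (simp add: conj_elt_mult conj_s b_1)
    also have "\<dots> = b m \<otimes> (b n \<otimes> b 1) \<otimes> a" by (simp add: m_assoc)
    also have "\<dots> = (b m \<otimes> b 1) \<otimes> (b n \<otimes> a)" by (simp only: flip: c2) (simp add: m_assoc)
    also have "\<dots> = b 1 \<otimes> (b m \<otimes> (a \<otimes> b n))" by (simp only: c3 flip: c1) (simp add: m_assoc)
    finally have "b 1 \<otimes> (a \<otimes> (b m \<otimes> b n)) = b 1 \<otimes> (b m \<otimes> (a \<otimes> b n))"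
      by (simp add: m_assoc)
    then have "a \<otimes> (b m \<otimes> b n) = b m \<otimes> (a \<otimes> b n)" by simp
    then have "(a \<otimes> b m) \<otimes> b n = (b m \<otimes> a) \<otimes> b n" by (simp add: m_assoc)
    then show ?thesis by simp
  qed auto
qed

abbreviation "V \<equiv> horner G a t"

lemma commutes_conj_V:
  assumes x: "x \<in> carrier G" "\<And>k. x \<otimes> b k = b k \<otimes> x"
  shows "x \<otimes> conj_elt G (V cs) (t [^] (k::nat)) = conj_elt G (V cs) (t [^] k) \<otimes> x"
proof (induction cs arbitrary: k)
  case (Cons c cs)
  have "conj_elt G (V (c # cs)) (t [^] k) = b k [^] c \<otimes> conj_elt G (V cs) (t [^] Suc k)"
    using group_commutes_pow[of t t k]
    by (simp add: conj_elt_mult conj_elt_int_pow conj_elt_conj_elt b_def)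
  moreover have "x \<otimes> b k [^] c = b k [^] c \<otimes> x"
    using int_pow_commute[of "b k" x c] x by simp
  ultimately show ?case
    using Cons[of "Suc k"] x(1)
    by (metis b_closed conj_elt_closed gens_closed horner_closed int_pow_closed m_assoc nat_pow_closed)
qed (use x in auto)

lemma a_commutes_conj_V: "a \<otimes> conj_elt G (V ds) t = conj_elt G (V ds) t \<otimes> a"
  using commutes_conj_V[of a ds 1] a_b_commute by simp

lemma V_mult: "\<exists>es. V cs \<otimes> V ds = V es"
proof (induction cs arbitrary: ds)
  case (Cons c cs)
  show ?case
  proof (cases ds)
    case Nil
    then show ?thesis by (intro exI[of _ "c # cs"]) simp
  next
    case (Cons d ds')
    obtain es where es: "V cs \<otimes> V ds' = V es" using Cons.IH by blast
    have "a [^] d \<otimes> conj_elt G (V cs) t = conj_elt G (V cs) t \<otimes> a [^] d"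
      using int_pow_commute a_commutes_conj_V by simp
    then have "V (c # cs) \<otimes> V ds = a [^] c \<otimes> a [^] d \<otimes> (conj_elt G (V cs) t \<otimes> conj_elt G (V ds') t)"
      using Cons by (simp add: m_assoc) (simp flip: m_assoc)
    also have "\<dots> = V ((c + d) # es)"
      by (simp add: int_pow_mult conj_elt_mult flip: es)
    finally show ?thesis by blast
  qed
qed (auto intro: exI[of _ ds])

lemma V_inv: "\<exists>ds. inv V cs = V ds"
proof (induction cs)
  case (Cons c cs)
  then obtain ds where ds: "inv V cs = V ds" by blast
  have "inv V (c # cs) = conj_elt G (V ds) t \<otimes> a [^] (- c)"
    by (simp add: inv_mult_group int_pow_neg conj_elt_inv flip: ds)
  also have "\<dots> = V (- c # ds)"
    using int_pow_commute[of a "conj_elt G (V ds) t" "- c"] a_commutes_conj_V by simp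
  finally show ?case by blast
qed (auto intro: exI[of _ "[]"])

lemma subgroup_V: "subgroup (range V) G"
proof (rule subgroupI)
  fix x y assume "x \<in> range V" "y \<in> range V"
  then obtain cs ds where "x = V cs" "y = V ds" by blast
  then show "inv x \<in> range V" "x \<otimes> y \<in> range V"
    unfolding image_iff using V_inv V_mult by simp_all
qed auto

lemma conj_t_V: "x \<in> range V \<Longrightarrow> conj_elt G x t \<in> range V"
proof -
  have "conj_elt G (V cs) t = V (0 # cs)" for cs by simp
  then show "x \<in> range V \<Longrightarrow> conj_elt G x t \<in> range V" by blast
qed

lemma conj_s_V: "x \<in> range V \<Longrightarrow> conj_elt G x s \<in> range V"
proof -
  interpret V: subgroup "range V" G by (rule subgroup_V)
  have "conj_elt G (V cs) s \<in> range V" for cs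
  proof (induction cs)
    case (Cons c cs)
    have "V [1, 1] = conj_elt G a s"
      using a_b_commute[of 1] by (simp add: conj_s b_1)
    then have "conj_elt G a s \<in> range V" by (metis rangeI)
    then have *: "conj_elt G a s [^] c \<in> range V"
      by (rule subgroup_int_pow_closed[OF subgroup_V])
    have "conj_elt G (conj_elt G (V cs) t) s = conj_elt G (conj_elt G (V cs) s) t"
      by (simp add: conj_elt_conj_elt st_commute)
    then have "conj_elt G (V (c # cs)) s =
        conj_elt G a s [^] c \<otimes> conj_elt G (conj_elt G (V cs) s) t"
      by (simp add: conj_elt_mult conj_elt_int_pow)
    then show ?case using * Cons conj_t_V by simp
  qed (auto intro!: range_eqI[of _ _ "[]"])
  then show "x \<in> range V \<Longrightarrow> conj_elt G x s \<in> range V" by auto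
qed

definition th :: "int \<Rightarrow> int \<Rightarrow> 'a" where "th i j = s [^] i \<otimes> t [^] j"

lemma th_closed [simp, intro]: "th i j \<in> carrier G"
  by (simp add: th_def)

lemma th_0 [simp]: "th 0 0 = \<one>"
  by (simp add: th_def)

lemma th_mult: "th i j \<otimes> th k l = th (i + k) (j + l)"
proof -
  have "t [^] j \<otimes> s [^] k = s [^] k \<otimes> t [^] j"
    using int_pow_commute[of t "s [^] k" j] int_pow_commute[of s t k] st_commute by simp
  then have "s [^] i \<otimes> (t [^] j \<otimes> s [^] k) \<otimes> t [^] l = s [^] i \<otimes> (s [^] k \<otimes> t [^] j) \<otimes> t [^] l"
    by simp
  then show ?thesis by (simp add: th_def int_pow_mult m_assoc)
qed

lemma inv_th: "inv (th i j) = th (- i) (- j)"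
  by (rule inv_equality) (auto simp: th_mult)

lemma conj_th_V:
  assumes "x \<in> range V" "m \<ge> 0" "n \<ge> 0"
  shows "conj_elt G x (th m n) \<in> range V"
proof -
  have *: "conj_elt G x (g [^] (k::nat)) \<in> range V"
    if "x \<in> range V" "g \<in> carrier G" "\<And>x. x \<in> range V \<Longrightarrow> conj_elt G x g \<in> range V" for x g k
  proof (induction k)
    case (Suc k)
    have "x \<in> carrier G" using that by auto
    then show ?case using that(3)[OF Suc] that by (simp add: conj_elt_conj_elt)
  qed (use that in auto)
  have "x \<in> carrier G" using assms by auto
  moreover have "conj_elt G (conj_elt G x (s [^] nat m)) (t [^] nat n) \<in> range V"
    by (intro * assms conj_s_V conj_t_V) auto
  ultimately show ?thesis
    using assms by (simp add: conj_elt_conj_elt th_def pow_nat)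
qed

definition base :: "'a set" where
  "base = {x \<in> carrier G. \<exists>m n. m \<ge> 0 \<and> n \<ge> 0 \<and> conj_elt G x (th m n) \<in> range V}"

lemma base_closed: "x \<in> base \<Longrightarrow> x \<in> carrier G"
  by (simp add: base_def)

lemma baseI:
  "x \<in> carrier G \<Longrightarrow> m \<ge> 0 \<Longrightarrow> n \<ge> 0 \<Longrightarrow> conj_elt G x (th m n) \<in> range V \<Longrightarrow> x \<in> base"
  by (auto simp: base_def)

lemma base_mult:
  assumes "x \<in> base" "y \<in> base"
  shows "x \<otimes> y \<in> base"
proof -
  obtain m n where x: "x \<in> carrier G" "m \<ge> 0" "n \<ge> 0" "conj_elt G x (th m n) \<in> range V"
    using assms by (auto simp: base_def)
  obtain k l where y: "y \<in> carrier G" "k \<ge> 0" "l \<ge> 0" "conj_elt G y (th k l) \<in> range V"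
    using assms by (auto simp: base_def)
  have "conj_elt G x (th (m + k) (n + l)) \<in> range V"
    using conj_th_V[OF x(4) y(2,3)] x by (simp add: conj_elt_conj_elt th_mult)
  moreover have "conj_elt G y (th (m + k) (n + l)) \<in> range V"
    using conj_th_V[OF y(4) x(2,3)] y by (simp add: conj_elt_conj_elt th_mult add.commute)
  ultimately have "conj_elt G (x \<otimes> y) (th (m + k) (n + l)) \<in> range V"
    using x(1) y(1) subgroup.m_closed[OF subgroup_V] by (simp add: conj_elt_mult)
  then show ?thesis
    using x y by (intro baseI[of _ "m + k" "n + l"]) auto
qed

lemma base_conj_th:
  assumes "x \<in> base"
  shows "conj_elt G x (th i j) \<in> base"
proof -
  obtain m n where x: "x \<in> carrier G" "m \<ge> 0" "n \<ge> 0" "conj_elt G x (th m n) \<in> range V"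
    using assms by (auto simp: base_def)
  have "conj_elt G (conj_elt G x (th i j)) (th (m + \<bar>i\<bar>) (n + \<bar>j\<bar>)) =
      conj_elt G (conj_elt G x (th m n)) (th (\<bar>i\<bar> + i) (\<bar>j\<bar> + j))"
    using x by (simp add: conj_elt_conj_elt th_mult add_ac)
  also have "\<dots> \<in> range V" by (rule conj_th_V[OF x(4)]) auto
  finally show ?thesis
    using x by (intro baseI[of _ "m + \<bar>i\<bar>" "n + \<bar>j\<bar>"]) auto
qed

lemma V_base: "V cs \<in> base"
  by (rule baseI[of _ 0 0]) auto

lemma eval_word_base_th:
  "\<exists>x\<in>base. \<exists>i j. eval_word G (case_gen a s t) w = x \<otimes> th i j"
proof (induction w)
  case Nil
  have "\<one> \<in> base" using V_base[of "[]"] by simp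
  moreover have "eval_word G (case_gen a s t) [] = \<one> \<otimes> th 0 0" by simp
  ultimately show ?case by blast
next
  case (Cons l w)
  then obtain x i j where x: "x \<in> base" "eval_word G (case_gen a s t) w = x \<otimes> th i j" by blast
  have xc: "x \<in> carrier G" using x base_closed by simp
  have th: "\<exists>y\<in>base. \<exists>i' j'. th k m \<otimes> (x \<otimes> th i j) = y \<otimes> th i' j'" for k m
  proof (intro bexI exI)
    show "conj_elt G x (th (- k) (- m)) \<in> base" by (rule base_conj_th[OF x(1)])
    show "th k m \<otimes> (x \<otimes> th i j) = conj_elt G x (th (- k) (- m)) \<otimes> th (k + i) (m + j)"
      using xc by (simp add: conj_elt_def inv_th m_assoc th_mult)
  qed
  have base: "\<exists>y\<in>base. \<exists>i' j'. z \<otimes> (x \<otimes> th i j) = y \<otimes> th i' j'" if "z \<in> base" for z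
    using base_mult[OF that x(1)] base_closed[OF that] xc
    by (intro bexI[of _ "z \<otimes> x"] exI[of _ i] exI[of _ j]) (auto simp: m_assoc)
  have "a \<in> base" "inv a \<in> base"
    using V_base[of "[1]"] V_base[of "[-1]"] by (simp_all add: int_pow_neg)
  moreover have "th 1 0 = s" "th 0 1 = t" "th (-1) 0 = inv s" "th 0 (-1) = inv t"
    by (simp_all add: th_def int_pow_neg)
  ultimately show ?case
    using th[of 1 0] th[of 0 1] th[of "-1" 0] th[of 0 "-1"] base
    by (cases l; cases "fst l") (auto simp: x(2))
qed

lemma eval_word_conj_eq_horner:
  "\<exists>m n i j cs. conj_elt G (eval_word G (case_gen a s t) w) (s [^] (m::int) \<otimes> t [^] (n::int)) =
     horner G a t cs \<otimes> (s [^] (i::int) \<otimes> t [^] (j::int))"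
proof -
  obtain x i j where x: "x \<in> base" "eval_word G (case_gen a s t) w = x \<otimes> th i j"
    using eval_word_base_th by blast
  then obtain m n where mn: "conj_elt G x (th m n) \<in> range V" and xc: "x \<in> carrier G"
    by (auto simp: base_def)
  then obtain cs where cs: "conj_elt G x (th m n) = V cs" by auto
  have "conj_elt G (th i j) (th m n) = th i j"
    by (rule conj_elt_commute) (auto simp: th_mult add.commute)
  then have "conj_elt G (x \<otimes> th i j) (th m n) = V cs \<otimes> th i j"
    using xc by (simp add: conj_elt_mult cs)
  then show ?thesis unfolding x(2) th_def by blast
qed

end

lemma Lambda_relators_eq:
  "Lambda_relators p =
    {free_gen Gen_a [^]\<^bsub>free_group\<^esub> p,
     comm_elt free_group (free_gen Gen_s) (free_gen Gen_t),
     comm_elt free_group (conj_elt free_group (free_gen Gen_a) (free_gen Gen_t)) (free_gen Gen_a),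
     conj_elt free_group (free_gen Gen_a) (free_gen Gen_s) \<otimes>\<^bsub>free_group\<^esub>
       inv\<^bsub>free_group\<^esub> (conj_elt free_group (free_gen Gen_a) (free_gen Gen_t)
         \<otimes>\<^bsub>free_group\<^esub> free_gen Gen_a)}"
  by (simp add: Lambda_relators_def Let_def)

lemma hom_comm_elt:
  assumes "group_hom G H h" "x \<in> carrier G" "y \<in> carrier G"
  shows "h (comm_elt G x y) = comm_elt H (h x) (h y)"
proof -
  interpret group_hom G H h by fact
  show ?thesis using assms(2,3) by (simp add: comm_elt_def)
qed

lemma group_hom_Lambda_relators:
  assumes "group_hom free_group G h"
  shows "(\<forall>r\<in>Lambda_relators p. h r = \<one>\<^bsub>G\<^esub>) \<longleftrightarrow>
    Lambda_group G (h (free_gen Gen_a)) (h (free_gen Gen_s)) (h (free_gen Gen_t)) \<and>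
    h (free_gen Gen_a) [^]\<^bsub>G\<^esub> p = \<one>\<^bsub>G\<^esub>"
proof -
  interpret group_hom free_group G h by fact
  show ?thesis
    unfolding Lambda_relators_eq Lambda_group_def Lambda_group_axioms_def
    by (auto simp: hom_nat_pow hom_comm_elt[OF assms] hom_conj_elt[OF assms])
qed

lemma Lambda_iso_image:
  fixes S :: "('g, 'h) monoid_scheme"
  assumes S: "Lambda_group S a s t" and ap: "a [^]\<^bsub>S\<^esub> p = \<one>\<^bsub>S\<^esub>"
    and faithful: "\<And>cs i j. horner S a t cs \<otimes>\<^bsub>S\<^esub> (s [^]\<^bsub>S\<^esub> (i::int) \<otimes>\<^bsub>S\<^esub> t [^]\<^bsub>S\<^esub> (j::int)) = \<one>\<^bsub>S\<^esub> \<Longrightarrow>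
      i = 0 \<and> j = 0 \<and> (\<forall>c\<in>set cs. int p dvd c)"
  shows "Lambda p \<cong> S\<lparr>carrier := eval_word S (case_gen a s t) ` carrier free_group\<rparr>"
proof -
  interpret S: Lambda_group S a s t by fact
  interpret F: group free_group by (rule group_free_group)
  let ?f = "case_gen a s t" and ?N = "normal_closure free_group (Lambda_relators p)"
  have f: "range ?f \<subseteq> carrier S" by (auto split: gen.splits)
  interpret phi: group_hom free_group S "eval_word S ?f"
    by unfold_locales (rule S.eval_word_hom[OF f])
  have R: "Lambda_relators p \<subseteq> carrier free_group"
    by (auto simp: Lambda_relators_eq)
  have rel: "eval_word S ?f r = \<one>\<^bsub>S\<^esub>" if "r \<in> Lambda_relators p" for r
    using group_hom_Lambda_relators[OF phi.group_hom_axioms, of p] S ap f that by simp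
  interpret N: normal ?N free_group by (rule F.normal_closure_normal[OF R])
  let ?Q = "free_group Mod ?N"
  let ?a = "free_gen Gen_a" and ?s = "free_gen Gen_s" and ?t = "free_gen Gen_t"
  define \<pi> where "\<pi> = (\<lambda>w. ?N #>\<^bsub>free_group\<^esub> w)"
  interpret pi: group_hom free_group ?Q \<pi>
    unfolding \<pi>_def
    by (intro group_hom.intro group_hom_axioms.intro F.is_group N.factorgroup_is_group N.r_coset_hom_Mod)
  have pi_one: "\<pi> w = \<one>\<^bsub>?Q\<^esub> \<longleftrightarrow> w \<in> ?N" if "w \<in> carrier free_group" for w
    using F.coset_join1[of ?N w] F.coset_join2[of w ?N] that N.subgroup_axioms N.subset
    by (auto simp: \<pi>_def FactGroup_def)
  interpret Q: Lambda_group ?Q "\<pi> ?a" "\<pi> ?s" "\<pi> ?t"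
    using group_hom_Lambda_relators[OF pi.group_hom_axioms, of p] pi_one R
      normal_closure_superset[of "Lambda_relators p" free_group] by blast
  have Qap: "\<pi> ?a [^]\<^bsub>?Q\<^esub> p = \<one>\<^bsub>?Q\<^esub>"
    using group_hom_Lambda_relators[OF pi.group_hom_axioms, of p] pi_one R
      normal_closure_superset[of "Lambda_relators p" free_group] by blast
  have Nker: "eval_word S ?f w = \<one>\<^bsub>S\<^esub>" if "w \<in> ?N" for w
  proof -
    have "?N \<subseteq> kernel free_group S (eval_word S ?f)"
      by (rule normal_closure_minimal[OF phi.normal_kernel]) (use rel R in \<open>auto simp: kernel_def\<close>)
    with that show ?thesis by (auto simp: kernel_def)
  qed
  have "w \<in> ?N" if w: "w \<in> carrier free_group" and ker: "eval_word S ?f w = \<one>\<^bsub>S\<^esub>" for w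
  proof -
    have "\<pi> \<circ> free_gen = case_gen (\<pi> ?a) (\<pi> ?s) (\<pi> ?t)"
      by (rule ext) (simp split: gen.splits)
    then have piw: "\<pi> w = eval_word ?Q (case_gen (\<pi> ?a) (\<pi> ?s) (\<pi> ?t)) w"
      using hom_eval_word[OF pi.group_hom_axioms, of free_gen w] free_group_eval_word[OF w]
      by (simp add: image_subset_iff)
    obtain m n i j cs where "conj_elt ?Q (\<pi> w) (\<pi> ?s [^]\<^bsub>?Q\<^esub> (m::int) \<otimes>\<^bsub>?Q\<^esub> \<pi> ?t [^]\<^bsub>?Q\<^esub> (n::int)) =
        horner ?Q (\<pi> ?a) (\<pi> ?t) cs \<otimes>\<^bsub>?Q\<^esub> (\<pi> ?s [^]\<^bsub>?Q\<^esub> (i::int) \<otimes>\<^bsub>?Q\<^esub> \<pi> ?t [^]\<^bsub>?Q\<^esub> (j::int))"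
      using Q.eval_word_conj_eq_horner[of w] unfolding piw by blast
    note eq = this
    let ?g = "?s [^]\<^bsub>free_group\<^esub> m \<otimes>\<^bsub>free_group\<^esub> ?t [^]\<^bsub>free_group\<^esub> n"
    let ?u = "conj_elt free_group w ?g"
    let ?v = "horner free_group ?a ?t cs \<otimes>\<^bsub>free_group\<^esub>
      (?s [^]\<^bsub>free_group\<^esub> i \<otimes>\<^bsub>free_group\<^esub> ?t [^]\<^bsub>free_group\<^esub> j)"
    have u: "?u \<in> carrier free_group" and v: "?v \<in> carrier free_group" using w by auto
    have "\<pi> ?u = \<pi> ?v"
      using eq w by (simp add: hom_conj_elt[OF pi.group_hom_axioms] pi.hom_int_pow
          hom_horner[OF pi.group_hom_axioms])
    then have "\<pi> (?u \<otimes>\<^bsub>free_group\<^esub> inv\<^bsub>free_group\<^esub> ?v) = \<one>\<^bsub>?Q\<^esub>"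
      using pi.H.r_inv[OF pi.hom_closed[OF v]]
      by (simp only: pi.hom_mult[OF u F.inv_closed[OF v]] pi.hom_inv[OF v])
    then have "?u \<otimes>\<^bsub>free_group\<^esub> inv\<^bsub>free_group\<^esub> ?v \<in> ?N"
      by (rule iffD1[OF pi_one[OF F.m_closed[OF u F.inv_closed[OF v]]]])
    then have "eval_word S ?f (?u \<otimes>\<^bsub>free_group\<^esub> inv\<^bsub>free_group\<^esub> ?v) = \<one>\<^bsub>S\<^esub>" by (rule Nker)
    then have "eval_word S ?f ?u \<otimes>\<^bsub>S\<^esub> inv\<^bsub>S\<^esub> eval_word S ?f ?v = \<one>\<^bsub>S\<^esub>"
      by (simp only: phi.hom_mult[OF u F.inv_closed[OF v]] phi.hom_inv[OF v])
    moreover have g: "?g \<in> carrier free_group" by simp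
    have "eval_word S ?f ?u = \<one>\<^bsub>S\<^esub>"
      unfolding hom_conj_elt[OF phi.group_hom_axioms w g] ker by (rule S.conj_elt_one[OF phi.hom_closed[OF g]])
    ultimately have "inv\<^bsub>S\<^esub> eval_word S ?f ?v = \<one>\<^bsub>S\<^esub>"
      by (simp only: S.l_one[OF S.inv_closed[OF phi.hom_closed[OF v]]])
    then have "eval_word S ?f ?v = \<one>\<^bsub>S\<^esub>"
      using S.inv_eq_1_iff[OF phi.hom_closed[OF v]] by blast
    then have "horner S a t cs \<otimes>\<^bsub>S\<^esub> (s [^]\<^bsub>S\<^esub> i \<otimes>\<^bsub>S\<^esub> t [^]\<^bsub>S\<^esub> j) = \<one>\<^bsub>S\<^esub>"
      by (simp add: phi.hom_int_pow hom_horner[OF phi.group_hom_axioms] S.eval_word_free_gen[OF f]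
          del: eval_word.simps)
    from faithful[OF this] have "i = 0" "j = 0" "\<forall>c\<in>set cs. int p dvd c" by auto
    then have "horner ?Q (\<pi> ?a) (\<pi> ?t) cs = \<one>\<^bsub>?Q\<^esub>"
      by (intro pi.H.horner_eq_one[OF _ _ Qap]) auto
    with eq \<open>i = 0\<close> \<open>j = 0\<close>
    have "conj_elt ?Q (\<pi> w) (\<pi> ?s [^]\<^bsub>?Q\<^esub> m \<otimes>\<^bsub>?Q\<^esub> \<pi> ?t [^]\<^bsub>?Q\<^esub> n) = \<one>\<^bsub>?Q\<^esub>"
      by (metis int_pow_0 pi.H.one_closed pi.H.l_one)
    then have "\<pi> w = \<one>\<^bsub>?Q\<^esub>"
      using pi.H.conj_elt_eq_one_iff[OF pi.hom_closed[OF w] pi.H.m_closed[OF pi.H.int_pow_closed pi.H.int_pow_closed]]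
        Q.gens_closed by simp
    then show "w \<in> ?N" using pi_one w by blast
  qed
  then show ?thesis
    unfolding Lambda_def by (intro presented_group_iso_image S.is_group f rel R)
qed

section \<open>The torus, valuations and polynomials at the three places\<close>

definition diagonal_matrix :: "'a::zero ^ 'n \<Rightarrow> 'a ^ 'n ^ 'n" where
  "diagonal_matrix v = (\<chi> i j. if i = j then v $ i else 0)"

lemma diagonal_matrix_nth [simp]: "diagonal_matrix v $ i $ j = (if i = j then v $ i else 0)"
  by (simp add: diagonal_matrix_def)

lemma diagonal_matrix_inject [simp]: "diagonal_matrix v = diagonal_matrix w \<longleftrightarrow> v = w"
  by (auto simp: vec_eq_iff)

lemma diagonal_matrix_vector_mult [simp]:
  fixes v :: "'a::semiring_1 ^ 'n"
  shows "diagonal_matrix v *v w = v * w"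
  by (simp add: vec_eq_iff matrix_vector_mult_def if_distrib[of "\<lambda>x. x * _"] cong: if_cong)

lemma diagonal_matrix_mult [simp]:
  fixes v :: "'a::semiring_1 ^ 'n"
  shows "diagonal_matrix v ** diagonal_matrix w = diagonal_matrix (v * w)"
  by (simp add: vec_eq_iff matrix_matrix_mult_def if_distrib[of "\<lambda>x. x * _"] cong: if_cong)

lemma mat_1_eq_diagonal_matrix: "mat 1 = diagonal_matrix 1"
  by (simp add: vec_eq_iff mat_def)

lemma fls_abs_eq_1_iff:
  fixes f :: "'a::{field, finite} fls"
  shows "fls_abs f = 1 \<longleftrightarrow> f \<noteq> 0 \<and> fls_subdegree f = 0"
proof -
  have "card {0, 1 :: 'a} \<le> CARD('a)" by (rule card_mono) auto
  then have "CARD('a) \<ge> 2" by simp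
  then have "real CARD('a) ^ n = 1 \<longleftrightarrow> n = 0" for n
    using power_inject_exp[of "real CARD('a)" n 0] by simp
  then show ?thesis by (auto simp: fls_abs_def power_int_def power_inverse)
qed

lemma fls_subdegree_prod:
  fixes f :: "'b \<Rightarrow> 'a::field fls"
  assumes "finite I" "\<And>i. i \<in> I \<Longrightarrow> f i \<noteq> 0"
  shows "fls_subdegree (prod f I) = (\<Sum>i\<in>I. fls_subdegree (f i))"
  using assms by (induction I) auto

lemma diagonal_matrix_in_norm_one_diag:
  fixes v :: "'a::{field, finite} fls ^ 'n"
  shows "diagonal_matrix v \<in> norm_one_diag fls_abs \<longleftrightarrow>
    (\<forall>i. v $ i \<noteq> 0) \<and> (\<Sum>i\<in>UNIV. fls_subdegree (v $ i)) = 0"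
proof -
  have "det (diagonal_matrix v) = (\<Prod>i\<in>UNIV. v $ i)"
    by (subst det_diagonal) auto
  then show ?thesis
    by (auto simp: norm_one_diag_def invertible_det_nz fls_abs_eq_1_iff fls_subdegree_prod)
qed

lemma norm_one_diag_obtain:
  assumes "A \<in> norm_one_diag nrm"
  obtains v where "A = diagonal_matrix v"
proof
  show "A = diagonal_matrix (\<chi> i. A $ i $ i)"
    using assms by (auto simp: norm_one_diag_def vec_eq_iff)
qed

text \<open>The images of \<open>X\<close> and \<open>X + 1\<close> in the completions at \<open>0\<close>, \<open>-1\<close>, \<open>\<infinity>\<close>, for the local parameters
  \<open>X\<close>, \<open>X + 1\<close>, \<open>1/X\<close>.\<close>

definition x_pt :: "'a::field fls ^ 3" where
  "x_pt = vector [fls_X, fls_X - 1, fls_X_inv]"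

definition y_pt :: "'a::field fls ^ 3" where
  "y_pt = vector [fls_X + 1, fls_X, fls_X_inv + 1]"

lemma x_pt_nth [simp]: "x_pt $ 1 = fls_X" "x_pt $ 2 = fls_X - 1" "x_pt $ 3 = fls_X_inv"
  by (simp_all add: x_pt_def)

lemma y_pt_nth [simp]: "y_pt $ 1 = fls_X + 1" "y_pt $ 2 = fls_X" "y_pt $ 3 = fls_X_inv + 1"
  by (simp_all add: y_pt_def)

lemma y_pt_eq: "y_pt = x_pt + 1"
  by (simp add: vec_eq_iff forall_3)

lemma fls_X_minus_1:
  "fls_subdegree (fls_X - 1 :: 'a::field fls) = 0" "fls_X - 1 \<noteq> (0 :: 'a::field fls)"
proof -
  show *: "fls_subdegree (fls_X - 1 :: 'a::field fls) = 0"
    by (subst fls_subdegree_diff_eq2) auto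
  show "fls_X - 1 \<noteq> (0 :: 'a::field fls)"
    by (rule fls_nonzeroI[of _ 0]) simp
qed

lemma fls_X_plus_1:
  "fls_subdegree (fls_X + 1 :: 'a::field fls) = 0" "fls_X + 1 \<noteq> (0 :: 'a::field fls)"
proof -
  show "fls_subdegree (fls_X + 1 :: 'a::field fls) = 0"
    by (subst fls_subdegree_add_eq2) auto
  show "fls_X + 1 \<noteq> (0 :: 'a::field fls)"
    by (rule fls_nonzeroI[of _ 0]) simp
qed

lemma fls_X_inv_plus_1:
  "fls_subdegree (fls_X_inv + 1 :: 'a::field fls) = -1" "fls_X_inv + 1 \<noteq> (0 :: 'a::field fls)"
proof -
  show "fls_subdegree (fls_X_inv + 1 :: 'a::field fls) = -1"
    by (subst fls_subdegree_add_eq1) auto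
  then show "fls_X_inv + 1 \<noteq> (0 :: 'a::field fls)" by auto
qed

lemma x_pt_nonzero [simp]: "(x_pt :: 'a::field fls ^ 3) $ k \<noteq> 0"
  using exhaust_3[of k] fls_X_minus_1(2)[where 'a='a] by auto

lemma y_pt_nonzero [simp]: "y_pt $ k \<noteq> 0"
  using exhaust_3[of k] by (auto simp: fls_X_plus_1 fls_X_inv_plus_1)

definition tor :: "int \<Rightarrow> int \<Rightarrow> 'a::field fls ^ 3" where
  "tor i j = (\<chi> k. (y_pt $ k) powi i * (x_pt $ k) powi j)"

lemma tor_nonzero [simp]: "tor i j $ k \<noteq> 0"
  by (simp add: tor_def)

lemma tor_mult: "tor i j * tor k l = tor (i + k) (j + l)"
  by (simp add: tor_def vec_eq_iff power_int_add)

lemma tor_0 [simp]: "tor 0 0 = 1"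
  by (simp add: tor_def vec_eq_iff)

lemma tor_0_1: "tor 0 1 = x_pt" and tor_1_0: "tor 1 0 = y_pt"
  by (simp_all add: tor_def vec_eq_iff)

lemma subdegree_tor_nth:
  "fls_subdegree ((tor i j :: 'a::field fls ^ 3) $ k) =
    i * fls_subdegree ((y_pt :: 'a fls ^ 3) $ k) + j * fls_subdegree ((x_pt :: 'a fls ^ 3) $ k)"
  by (simp add: tor_def)

lemma subdegree_tor [simp]:
  "fls_subdegree (tor i j $ 1) = j"
  "fls_subdegree (tor i j $ 2) = i"
  "fls_subdegree (tor i j $ 3) = - i - j"
  by (simp_all add: subdegree_tor_nth fls_X_plus_1 fls_X_inv_plus_1 fls_X_minus_1)

lemma tor_inject: "tor i j = tor k l \<longleftrightarrow> i = k \<and> j = l"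
  by (metis subdegree_tor(1,2))

definition sol :: "'a::field fls ^ 3 \<Rightarrow> int \<Rightarrow> int \<Rightarrow> ('a fls ^ 3) \<times> ('a fls ^ 3 ^ 3)" where
  "sol f i j = (f, diagonal_matrix (tor i j))"

abbreviation "SOL3 \<equiv> SOL fls_abs :: (('a::{field, finite} fls ^ 3) \<times> ('a fls ^ 3 ^ 3)) monoid"

lemma sol_inject [simp]: "sol f i j = sol g k l \<longleftrightarrow> f = g \<and> i = k \<and> j = l"
  by (simp add: sol_def tor_inject)

lemma sol_closed [simp, intro]: "sol f i j \<in> carrier SOL3"
  by (simp add: sol_def SOL_def diagonal_matrix_in_norm_one_diag sum_3)

lemma sol_one: "\<one>\<^bsub>SOL3\<^esub> = sol 0 0 0"
  by (simp add: SOL_def sol_def mat_1_eq_diagonal_matrix)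

lemma sol_mult [simp]: "sol f i j \<otimes>\<^bsub>SOL3\<^esub> sol g k l = sol (f + tor i j * g) (i + k) (j + l)"
  by (simp add: SOL_def sol_def tor_mult)

lemma sol_inv [simp]:
  "inv\<^bsub>SOL3\<^esub> (sol f i j :: ('a::{field, finite} fls ^ 3) \<times> _) = sol (- (tor (- i) (- j) * f)) (- i) (- j)"
proof -
  interpret group "SOL3 :: (('a fls ^ 3) \<times> ('a fls ^ 3 ^ 3)) monoid" by (rule group_SOL)
  show ?thesis by (rule inv_equality) (auto simp: sol_one)
qed

lemma conj_elt_sol:
  "conj_elt SOL3 (sol f i j) (sol 0 k l) = sol (tor (- k) (- l) * f) i j"
  by (simp add: conj_elt_def algebra_simps)

lemma sol_unipotent_int_pow:
  "sol f 0 0 [^]\<^bsub>SOL3\<^esub> (c::int) = sol (of_int c * f) 0 0"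
proof -
  have nat: "sol f 0 0 [^]\<^bsub>SOL3\<^esub> (n::nat) = sol (of_nat n * f) 0 0" for n
    by (induction n) (simp_all add: nat_pow_def sol_one algebra_simps)
  show ?thesis
    by (cases c rule: int_cases2) (simp_all add: int_pow_def2 nat sol_one)
qed

lemma sol_torus_int_pow:
  "sol 0 i j [^]\<^bsub>SOL3\<^esub> (c::int) = sol 0 (c * i) (c * j)"
proof -
  have nat: "sol 0 i j [^]\<^bsub>SOL3\<^esub> (n::nat) = sol 0 (n * i) (n * j)" for n
    by (induction n) (simp_all add: nat_pow_def sol_one algebra_simps)
  show ?thesis
    by (cases c rule: int_cases2) (simp_all add: int_pow_def2 nat sol_one)
qed

text \<open>Stated by coefficients because \<open>fls_subdegree 0 = 0\<close>: zero has order at least \<open>n\<close> for every \<open>n\<close>.\<close>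

definition ord_ge :: "int \<Rightarrow> 'a::zero fls \<Rightarrow> bool" where
  "ord_ge n f \<longleftrightarrow> (\<forall>i<n. fls_nth f i = 0)"

lemma ord_ge_iff: "ord_ge n f \<longleftrightarrow> f = 0 \<or> n \<le> fls_subdegree f"
  by (auto simp: ord_ge_def intro: fls_subdegree_geI)

lemma ord_ge_0 [simp]: "ord_ge n 0"
  by (simp add: ord_ge_def)

lemma ord_ge_add: "ord_ge n f \<Longrightarrow> ord_ge n g \<Longrightarrow> ord_ge n (f + g)"
  for f g :: "'a::group_add fls"
  by (simp add: ord_ge_def)

lemma ord_ge_mono: "ord_ge n f \<Longrightarrow> m \<le> n \<Longrightarrow> ord_ge m f"
  by (simp add: ord_ge_def)

lemma ord_ge_mult: "ord_ge m f \<Longrightarrow> ord_ge n g \<Longrightarrow> ord_ge (m + n) (f * g)"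
  for f g :: "'a::field fls"
  by (cases "f = 0 \<or> g = 0") (auto simp: ord_ge_iff)

interpretation fls_const_hom: comm_ring_hom "fls_const :: 'a::comm_ring_1 \<Rightarrow> 'a fls"
  by unfold_locales (simp_all add: fls_plus_const)

definition fls_eval :: "'a::field poly \<Rightarrow> 'a fls \<Rightarrow> 'a fls" where
  "fls_eval f z = poly (map_poly fls_const f) z"

lemma fls_eval_0 [simp]: "fls_eval 0 z = 0"
  by (simp add: fls_eval_def)

lemma fls_eval_pCons [simp]: "fls_eval (pCons c f) z = fls_const c + z * fls_eval f z"
  by (simp add: fls_eval_def fls_const_hom.map_poly_pCons_hom)

lemma fls_eval_pcompose: "fls_eval (pcompose f g) z = fls_eval f (fls_eval g z)"
  by (simp add: fls_eval_def fls_const_hom.map_poly_pcompose poly_pcompose)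

lemma fls_nth_eval_X: "fls_nth (fls_eval f fls_X) n = (if n < 0 then 0 else poly.coeff f (nat n))"
proof (induction f arbitrary: n)
  case (pCons c f)
  show ?case
    by (cases "n \<le> 0") (auto simp: pCons fls_X_times_conv_shift coeff_pCons nat_diff_distrib split: nat.splits)
qed simp

lemma fls_nth_eval_X_inv:
  "fls_nth (fls_eval f fls_X_inv) n = (if n > 0 then 0 else poly.coeff f (nat (- n)))"
proof (induction f arbitrary: n)
  case (pCons c f)
  show ?case
    by (cases "n \<ge> 0") (auto simp: pCons fls_X_inv_times_conv_shift coeff_pCons nat_diff_distrib split: nat.splits)
qed simp

lemma fls_eval_X_eq_0_iff: "fls_eval f fls_X = 0 \<longleftrightarrow> f = 0"
proof
  assume "fls_eval f fls_X = 0"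
  then have "poly.coeff f n = 0" for n using fls_nth_eval_X[of f "int n"] by simp
  then show "f = 0" by (simp add: poly_eq_iff)
qed auto

lemma ord_ge_eval_X_imp_dvd:
  assumes "ord_ge n (fls_eval f fls_X)"
  shows "[:0, 1:] ^ nat n dvd f"
proof -
  have "poly.coeff f k = 0" if "k < nat n" for k
    using assms that fls_nth_eval_X[of f "int k"] by (simp add: ord_ge_def)
  then show ?thesis by (simp add: monom_1_dvd_iff' flip: monom_altdef[of 1, simplified])
qed

lemma ord_ge_eval_X_minus_1_imp_dvd:
  fixes f :: "'a::field poly"
  assumes "ord_ge n (fls_eval f (fls_X - 1))"
  shows "[:1, 1:] ^ nat n dvd f"
proof -
  have "fls_eval [:-1, 1:] fls_X = (fls_X - 1 :: 'a fls)"
    by (simp add: fls_const_hom.hom_uminus)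
  then have "ord_ge n (fls_eval (pcompose f [:-1, 1:]) fls_X)"
    using assms by (simp add: fls_eval_pcompose del: fls_eval_pCons)
  then obtain g where "pcompose f [:-1, 1:] = [:0, 1:] ^ nat n * g"
    using ord_ge_eval_X_imp_dvd by blast
  then have "pcompose (pcompose f [:-1, 1:]) [:1, 1:] = [:1, 1:] ^ nat n * pcompose g [:1, 1:]"
    by (simp add: pcompose_mult pcompose_hom.hom_power pcompose_pCons)
  moreover have "pcompose (pcompose f [:-1, 1:]) [:1, 1:] = f"
    by (simp add: pcompose_assoc[symmetric] pcompose_pCons)
  ultimately show ?thesis by (metis dvd_triv_left)
qed

text \<open>In terms of \<open>f / (X\<^sup>n (X + 1)\<^sup>m)\<close>: a rational function with no pole at all and a zero at \<open>\<infinity>\<close>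
  vanishes.\<close>

lemma S_integer_zero:
  fixes f :: "'a::field poly"
  assumes "ord_ge n (fls_eval f fls_X)" "ord_ge m (fls_eval f (fls_X - 1))"
    "ord_ge (1 - m - n) (fls_eval f fls_X_inv)"
  shows "f = 0"
proof (rule ccontr)
  assume f: "f \<noteq> 0"
  have "nat n \<le> Polynomial.order 0 f"
    using ord_ge_eval_X_imp_dvd[OF assms(1)] f order_divides[of 0 "nat n" f] by simp
  moreover have "nat m \<le> Polynomial.order (-1) f"
    using ord_ge_eval_X_minus_1_imp_dvd[OF assms(2)] f order_divides[of "-1" "nat m" f] by simp
  moreover have "Polynomial.order 0 f + Polynomial.order (-1) f \<le> Polynomial.degree f"
  proof -
    have "Polynomial.order 0 f + Polynomial.order (-1) f = (\<Sum>x\<in>{0,-1}. Polynomial.order x f)" by simp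
    also have "\<dots> = (\<Sum>x\<in>{x\<in>{0,-1}. poly f x = 0}. Polynomial.order x f)"
      by (rule sum.mono_neutral_right) (use f in \<open>auto simp: order_root\<close>)
    also have "\<dots> \<le> (\<Sum>x | poly f x = 0. Polynomial.order x f)"
      by (rule sum_mono2) (auto simp: poly_roots_finite[OF f])
    also have "\<dots> \<le> Polynomial.degree f" by (rule sum_order_le_degree[OF f])
    finally show ?thesis .
  qed
  moreover have "int (Polynomial.degree f) \<le> m + n - 1"
  proof (rule ccontr)
    assume "\<not> ?thesis"
    then have "fls_nth (fls_eval f fls_X_inv) (- int (Polynomial.degree f)) = 0"
      using assms(3) by (simp add: ord_ge_def)
    then show False using f by (simp add: fls_nth_eval_X_inv)
  qed
  ultimately show False by linarith
qed

section \<open>The image in SOL\<close>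

lemma of_int_vec_nth [simp]: "(of_int c :: 'a::ring_1 ^ 'n) $ i = of_int c"
  by (cases c rule: int_cases2) (simp_all add: of_nat_index)

type_synonym 'p SOL_elt = "('p mod_ring fls ^ 3) \<times> ('p mod_ring fls ^ 3 ^ 3)"

lemma Lambda_group_SOL:
  "Lambda_group (SOL3 :: (('a::{field, finite} fls ^ 3) \<times> ('a fls ^ 3 ^ 3)) monoid)
     (sol 1 0 0) (sol 0 (-1) 0) (sol 0 0 (-1))"
  by (intro Lambda_group.intro Lambda_group_axioms.intro group_SOL)
    (simp_all add: conj_elt_sol comm_elt_def sol_one tor_0_1 tor_1_0 y_pt_eq)

lemma sol_1_pow_CARD:
  "(sol 1 0 0 :: 'p::prime_card SOL_elt) [^]\<^bsub>SOL3\<^esub> CARD('p) = \<one>\<^bsub>SOL3\<^esub>"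
proof -
  have "(of_nat CARD('p) :: 'p mod_ring fls) = fls_const (of_nat CARD('p))"
    by (rule fls_of_nat)
  also have "(of_nat CARD('p) :: 'p mod_ring) = 0"
    using of_nat_CHAR[where 'a = "'p mod_ring"] by simp
  finally have *: "(of_nat CARD('p) :: 'p mod_ring fls ^ 3) = 0"
    by (simp add: vec_eq_iff of_nat_index)
  show ?thesis
    using sol_unipotent_int_pow[of "1 :: 'p mod_ring fls ^ 3" "int CARD('p)"]
    by (simp add: int_pow_int sol_one *)
qed

definition poly_vec :: "'a::field poly \<Rightarrow> 'a fls ^ 3" where
  "poly_vec f = (\<chi> k. fls_eval f (x_pt $ k))"

lemma poly_vec_0 [simp]: "poly_vec 0 = 0"
  by (simp add: poly_vec_def vec_eq_iff)

lemma poly_vec_eq_0_iff [simp]: "poly_vec f = 0 \<longleftrightarrow> f = 0"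
proof
  assume "poly_vec f = 0"
  then have "poly_vec f $ 1 = 0" by simp
  then show "f = 0" by (simp add: poly_vec_def fls_eval_X_eq_0_iff)
qed simp

lemma horner_SOL:
  "horner SOL3 (sol 1 0 0) (sol 0 0 (-1)) cs = sol (poly_vec (Poly (map of_int cs))) 0 0"
proof (induction cs)
  case (Cons c cs)
  have "of_int c + x_pt * poly_vec (Poly (map of_int cs)) = poly_vec (Poly (map of_int (c # cs)))"
    by (simp add: vec_eq_iff poly_vec_def fls_of_int)
  with Cons show ?case
    by (simp add: conj_elt_sol sol_unipotent_int_pow tor_0_1)
qed (simp add: sol_one)

lemma SOL_faithful:
  assumes "horner SOL3 (sol 1 0 0 :: 'p::prime_card SOL_elt) (sol 0 0 (-1)) cs
      \<otimes>\<^bsub>SOL3\<^esub> (sol 0 (-1) 0 [^]\<^bsub>SOL3\<^esub> (i::int) \<otimes>\<^bsub>SOL3\<^esub> sol 0 0 (-1) [^]\<^bsub>SOL3\<^esub> (j::int)) = \<one>\<^bsub>SOL3\<^esub>"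
  shows "i = 0 \<and> j = 0 \<and> (\<forall>c\<in>set cs. int CARD('p) dvd c)"
proof -
  have "i = 0 \<and> j = 0" and P: "Poly (map of_int cs) = (0 :: 'p mod_ring poly)"
    using assms by (simp_all add: horner_SOL sol_torus_int_pow sol_one)
  moreover have "\<forall>c\<in>set cs. (of_int c :: 'p mod_ring) = 0"
    using P by (induction cs) auto
  ultimately show ?thesis by (simp add: of_int_eq_0_iff_char_dvd)
qed

text \<open>Conjugation \<open>a\<^sup>t\<close> means \<open>t\<^sup>-\<^sup>1 a t\<close>, so \<open>t\<close> and \<open>s\<close> are sent to the inverses of \<open>X\<close> and \<open>X + 1\<close>.\<close>

definition Lambda_SOL :: "'p::prime_card SOL_elt set" where
  "Lambda_SOL = eval_word SOL3 (case_gen (sol 1 0 0) (sol 0 (-1) 0) (sol 0 0 (-1))) ` carrier free_group"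

lemma Lambda_iso_Lambda_SOL:
  "Lambda CARD('p::prime_card) \<cong> SOL3\<lparr>carrier := Lambda_SOL :: 'p SOL_elt set\<rparr>"
  unfolding Lambda_SOL_def
  by (rule Lambda_iso_image[OF Lambda_group_SOL sol_1_pow_CARD SOL_faithful])

lemma subgroup_Lambda_SOL: "subgroup (Lambda_SOL :: 'p::prime_card SOL_elt set) SOL3"
  and gens_in_Lambda_SOL:
    "(sol 1 0 0 :: 'p SOL_elt) \<in> Lambda_SOL" "(sol 0 (-1) 0 :: 'p SOL_elt) \<in> Lambda_SOL"
    "(sol 0 0 (-1) :: 'p SOL_elt) \<in> Lambda_SOL"
proof -
  let ?f = "case_gen (sol 1 0 0 :: 'p SOL_elt) (sol 0 (-1) 0) (sol 0 0 (-1))"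
  interpret S: group "SOL3 :: 'p SOL_elt monoid" by (rule group_SOL)
  have f: "range ?f \<subseteq> carrier SOL3" by (auto split: gen.splits)
  interpret h: group_hom free_group SOL3 "eval_word SOL3 ?f"
    by (intro group_hom.intro group_hom_axioms.intro group_free_group group_SOL S.eval_word_hom[OF f])
  show "subgroup (Lambda_SOL :: 'p SOL_elt set) SOL3"
    unfolding Lambda_SOL_def by (rule h.img_is_subgroup)
  have "?f g \<in> Lambda_SOL" for g
    unfolding Lambda_SOL_def using S.eval_word_free_gen[OF f, of g] by (metis free_gen_closed imageI)
  from this[of Gen_a] this[of Gen_s] this[of Gen_t]
  show "(sol 1 0 0 :: 'p SOL_elt) \<in> Lambda_SOL" "(sol 0 (-1) 0 :: 'p SOL_elt) \<in> Lambda_SOL"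
    "(sol 0 0 (-1) :: 'p SOL_elt) \<in> Lambda_SOL"
    by simp_all
qed

lemma Lambda_SOL_form:
  assumes "h \<in> Lambda_SOL"
  obtains m n f i j where "h = sol (tor m n * poly_vec f) i j"
proof -
  interpret S: Lambda_group "SOL3 :: 'a SOL_elt monoid" "sol 1 0 0" "sol 0 (-1) 0" "sol 0 0 (-1)"
    by (rule Lambda_group_SOL)
  from assms obtain w
    where w: "h = eval_word SOL3 (case_gen (sol 1 0 0) (sol 0 (-1) 0) (sol 0 0 (-1))) w"
    unfolding Lambda_SOL_def by blast
  obtain m n i j cs where
    "conj_elt SOL3 h (sol 0 (-1) 0 [^]\<^bsub>SOL3\<^esub> (m::int) \<otimes>\<^bsub>SOL3\<^esub> sol 0 0 (-1) [^]\<^bsub>SOL3\<^esub> (n::int)) =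
     horner SOL3 (sol 1 0 0) (sol 0 0 (-1)) cs \<otimes>\<^bsub>SOL3\<^esub>
       (sol 0 (-1) 0 [^]\<^bsub>SOL3\<^esub> (i::int) \<otimes>\<^bsub>SOL3\<^esub> sol 0 0 (-1) [^]\<^bsub>SOL3\<^esub> (j::int))"
    using S.eval_word_conj_eq_horner[of w] unfolding w by blast
  then have "conj_elt SOL3 h (sol 0 (- m) (- n)) = sol (poly_vec (Poly (map of_int cs))) (- i) (- j)"
    by (simp add: sol_torus_int_pow horner_SOL)
  then have "conj_elt SOL3 (conj_elt SOL3 h (sol 0 (- m) (- n))) (sol 0 m n) =
      sol (tor (- m) (- n) * poly_vec (Poly (map of_int cs))) (- i) (- j)"
    by (simp add: conj_elt_sol)
  moreover have "h \<in> carrier SOL3"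
    using assms subgroup.subset[OF subgroup_Lambda_SOL] by blast
  ultimately show thesis
    using that by (simp add: S.conj_elt_conj_elt flip: sol_one)
qed

lemma Lambda_SOL_small:
  fixes f :: "'p::prime_card mod_ring fls ^ 3"
  assumes "sol f 0 0 \<in> Lambda_SOL"
    and "ord_ge 0 (f $ 1)" "ord_ge 0 (f $ 2)" "ord_ge 1 (f $ 3)"
  shows "f = 0"
proof -
  obtain m n g where f: "f = tor m n * poly_vec g"
    using Lambda_SOL_form[OF assms(1)] by (metis sol_inject)
  then have g: "poly_vec g = tor (- m) (- n) * f"
    by (simp add: tor_mult flip: mult.assoc)
  have "g = 0"
  proof (rule S_integer_zero)
    have ord: "ord_ge (fls_subdegree ((tor (- m) (- n) :: 'p mod_ring fls ^ 3) $ k) + d)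
        (fls_eval g (x_pt $ k))"
      if "ord_ge d (f $ k)" for k d
    proof -
      have "fls_eval g (x_pt $ k) = tor (- m) (- n) $ k * f $ k"
        using arg_cong[OF g, of "\<lambda>v. v $ k"] by (simp add: poly_vec_def)
      moreover have "ord_ge (fls_subdegree ((tor (- m) (- n) :: 'p mod_ring fls ^ 3) $ k))
          ((tor (- m) (- n) :: 'p mod_ring fls ^ 3) $ k)"
        by (simp add: ord_ge_iff)
      ultimately show ?thesis using that by (simp only: ord_ge_mult)
    qed
    show "ord_ge (- n) (fls_eval g fls_X)" using ord[OF assms(2)] by simp
    show "ord_ge (- m) (fls_eval g (fls_X - 1))" using ord[OF assms(3)] by simp
    show "ord_ge (1 - - m - - n) (fls_eval g fls_X_inv)" using ord[OF assms(4)] by (simp add: algebra_simps)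
  qed
  then show ?thesis by (simp add: f)
qed

lemma sol_torus_in_Lambda_SOL: "(sol 0 i j :: 'p::prime_card SOL_elt) \<in> Lambda_SOL"
proof -
  interpret S: group "SOL3 :: 'p SOL_elt monoid" by (rule group_SOL)
  have "(sol 0 (-1) 0 :: 'p SOL_elt) [^]\<^bsub>SOL3\<^esub> (- i) \<otimes>\<^bsub>SOL3\<^esub> sol 0 0 (-1) [^]\<^bsub>SOL3\<^esub> (- j) \<in> Lambda_SOL"
    by (intro subgroup.m_closed[OF subgroup_Lambda_SOL] S.subgroup_int_pow_closed[OF subgroup_Lambda_SOL]
        gens_in_Lambda_SOL)
  then show ?thesis by (simp add: sol_torus_int_pow)
qed

lemma sol_unipotent_in_Lambda_SOL_tor:
  "(sol (of_int c * tor i j) 0 0 :: 'p::prime_card SOL_elt) \<in> Lambda_SOL"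
proof -
  interpret S: group "SOL3 :: 'p SOL_elt monoid" by (rule group_SOL)
  have "(sol 0 i j :: 'p SOL_elt) \<otimes>\<^bsub>SOL3\<^esub> sol 1 0 0 [^]\<^bsub>SOL3\<^esub> c \<otimes>\<^bsub>SOL3\<^esub> sol 0 (- i) (- j) \<in> Lambda_SOL"
    by (intro subgroup.m_closed[OF subgroup_Lambda_SOL] S.subgroup_int_pow_closed[OF subgroup_Lambda_SOL]
        gens_in_Lambda_SOL sol_torus_in_Lambda_SOL)
  then show ?thesis by (simp add: sol_unipotent_int_pow mult.commute)
qed

lemma sol_unipotent_add_in_Lambda_SOL:
  assumes "sol f 0 0 \<in> Lambda_SOL" "sol g 0 0 \<in> Lambda_SOL"
  shows "sol (f + g) 0 0 \<in> Lambda_SOL"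
  using subgroup.m_closed[OF subgroup_Lambda_SOL assms] by simp

text \<open>The poles of \<open>v\<close> are removed one order at a time: \<open>X\<^sup>-\<^sup>N\<close>, \<open>(X + 1)\<^sup>-\<^sup>N\<close> and \<open>X\<^sup>N\<close> have a pole of
  order \<open>N\<close> at \<open>0\<close>, \<open>-1\<close> and \<open>\<infinity>\<close> respectively, and none at the other two places.\<close>

lemma approximation:
  fixes v :: "'p::prime_card mod_ring fls ^ 3"
  assumes "\<And>k. ord_ge (- int n) (v $ k)"
  shows "\<exists>f. sol f 0 0 \<in> Lambda_SOL \<and> (\<forall>k. ord_ge 0 (v $ k - f $ k))"
  using assms
proof (induction n arbitrary: v)
  case 0
  have "sol 0 0 0 \<in> Lambda_SOL" by (rule sol_torus_in_Lambda_SOL)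
  then show ?case using 0 by (intro exI[of _ 0]) auto
next
  case (Suc n)
  define N where "N = int (Suc n)"
  have "\<exists>c. \<forall>k. fls_nth (v $ k) (- N) = of_int (c k)"
    by (rule choice) (metis of_int_mod_ring_to_int_mod_ring of_int_of_int_mod_ring)
  then obtain c where c: "\<And>k. fls_nth (v $ k) (- N) = of_int (c k)" by blast
  define f :: "'p mod_ring fls ^ 3"
    where "f = of_int (c 1) * tor 0 (- N) + of_int (c 2) * tor (- N) 0 + of_int (c 3) * tor 0 N"
  have ord: "ord_ge (- int n) ((v - f) $ k)" for k
  proof -
    have const: "of_int c = (fls_const (of_int c) :: 'p mod_ring fls)" for c by (simp add: fls_of_int)
    have "fls_nth (f $ k) (- N) = of_int (c k) \<and> ord_ge (- N) (f $ k)"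
    proof -
      have lead: "fls_nth ((tor 0 (- N) :: 'p mod_ring fls ^ 3) $ 1) (- N) = 1"
        "fls_nth ((tor (- N) 0 :: 'p mod_ring fls ^ 3) $ 2) (- N) = 1"
        "fls_nth ((tor 0 N :: 'p mod_ring fls ^ 3) $ 3) (- N) = 1"
        using power_int_of_nat[of "fls_X_inv :: 'p mod_ring fls" "Suc n"]
        by (simp_all add: tor_def N_def del: of_nat_Suc power_Suc)
      have "N > 0" by (simp add: N_def)
      then show ?thesis
        using exhaust_3[of k]
        by (auto simp: f_def ord_ge_def const lead fls_eq0_below_subdegree)
    qed
    then have "fls_nth ((v - f) $ k) i = 0" if "i < - int n" for i
      using Suc.prems[of k] that c[of k] by (cases "i = - N") (auto simp: ord_ge_def N_def)
    then show ?thesis by (simp add: ord_ge_def)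
  qed
  obtain g where g: "sol g 0 0 \<in> Lambda_SOL" "\<forall>k. ord_ge 0 ((v - f) $ k - g $ k)"
    using Suc.IH[OF ord] by blast
  have "sol f 0 0 \<in> Lambda_SOL"
    unfolding f_def by (intro sol_unipotent_add_in_Lambda_SOL sol_unipotent_in_Lambda_SOL_tor)
  then have "sol (f + g) 0 0 \<in> Lambda_SOL"
    using g(1) by (rule sol_unipotent_add_in_Lambda_SOL)
  moreover have "\<forall>k. ord_ge 0 (v $ k - (f + g) $ k)" using g(2) by (simp add: diff_diff_eq)
  ultimately show ?case by blast
qed

definition box :: "('a::field fls ^ 3) set" where
  "box = {v. \<forall>k. ord_ge 0 (v $ k)}"

definition unit_box :: "('a::field fls ^ 3) set" where
  "unit_box = {v. \<forall>k. v $ k \<noteq> 0 \<and> fls_subdegree (v $ k) = 0}"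

lemma SOL_decomposition:
  fixes g :: "'p::prime_card SOL_elt"
  assumes "g \<in> carrier SOL3"
  obtains w c h where "w \<in> box" "c \<in> unit_box" "h \<in> Lambda_SOL"
    "g = (w, diagonal_matrix c) \<otimes>\<^bsub>SOL3\<^esub> h"
proof -
  obtain v A where "g = (v, A)" by (cases g)
  then have gA: "g = (v, A)" "A \<in> norm_one_diag fls_abs" using assms by (simp_all add: SOL_def)
  then obtain u where "A = diagonal_matrix u" using norm_one_diag_obtain by blast
  with gA have g: "g = (v, diagonal_matrix u)" and D: "diagonal_matrix u \<in> norm_one_diag fls_abs"
    by simp_all
  from D have u: "\<And>k. u $ k \<noteq> 0" and sum: "(\<Sum>k\<in>UNIV. fls_subdegree (u $ k)) = 0"
    by (simp_all add: diagonal_matrix_in_norm_one_diag)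
  define i j where "i = fls_subdegree (u $ 2)" and "j = fls_subdegree (u $ 1)"
  define c where "c = tor (- i) (- j) * u"
  have "fls_subdegree (c $ k) = 0" for k
    using exhaust_3[of k] sum u by (auto simp: c_def i_def j_def sum_3)
  then have c: "c \<in> unit_box" using u by (simp add: unit_box_def c_def)
  define c' where "c' = (\<chi> k. inverse (c $ k))"
  have cc': "c * c' = 1" using c by (simp add: c'_def unit_box_def vec_eq_iff)
  define n where "n = (\<Sum>k\<in>UNIV. nat (- fls_subdegree ((c' * v) $ k)))"
  have "ord_ge (- int n) ((c' * v) $ k)" for k
  proof -
    have "nat (- fls_subdegree ((c' * v) $ k)) \<le> n"
      unfolding n_def by (rule member_le_sum) auto
    then show ?thesis unfolding ord_ge_iff by linarith
  qed
  from approximation[OF this] obtain f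
    where f: "sol f 0 0 \<in> Lambda_SOL" "\<And>k. ord_ge 0 ((c' * v) $ k - f $ k)" by blast
  define w where "w = c * (c' * v - f)"
  have "ord_ge (0 + 0) (w $ k)" for k
    unfolding w_def vector_mult_component
    using c f(2)[of k] by (intro ord_ge_mult) (simp_all add: unit_box_def ord_ge_iff[of _ "c $ k"])
  then have w: "w \<in> box" by (simp add: box_def)
  have "sol f 0 0 \<otimes>\<^bsub>SOL3\<^esub> sol 0 i j \<in> Lambda_SOL"
    by (intro subgroup.m_closed[OF subgroup_Lambda_SOL] f(1) sol_torus_in_Lambda_SOL)
  then have h: "sol f i j \<in> Lambda_SOL" by simp
  have "w + c * f = v"
    using cc' by (simp add: w_def algebra_simps flip: mult.assoc)
  moreover have "c * tor i j = (tor (- i) (- j) * tor i j) * u"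
    by (simp only: c_def mult_ac)
  then have "c * tor i j = u" by (simp add: tor_mult)
  ultimately have "g = (w, diagonal_matrix c) \<otimes>\<^bsub>SOL3\<^esub> sol f i j"
    by (simp add: g SOL_def sol_def)
  with w c h show thesis by (rule that)
qed

section \<open>Discreteness and cocompactness\<close>

lemma dist_fls_imp_ord_ge:
  fixes f g :: "'a::group_add fls"
  assumes "dist f g < inverse (2 ^ n)"
  shows "ord_ge (int n) (f - g)"
proof (cases "f = g")
  case False
  have le1: "inverse (2 ^ n) \<le> (1::real)" by (simp add: inverse_le_1_iff)
  have "fls_subdegree (f - g) \<ge> 0"
  proof (rule ccontr)
    assume "\<not> ?thesis"
    then have "dist f g = 2 ^ nat (- fls_subdegree (f - g))"
      using False by (simp add: dist_fls_def)
    moreover have "(1::real) \<le> 2 ^ nat (- fls_subdegree (f - g))" by simp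
    ultimately show False using assms le1 by linarith
  qed
  with False assms have "(2::real) ^ n < 2 ^ nat (fls_subdegree (f - g))"
    by (simp add: dist_fls_def)
  then have "n < nat (fls_subdegree (f - g))" by simp
  then have "int n \<le> fls_subdegree (f - g)" by linarith
  then show ?thesis by (simp add: ord_ge_iff)
qed (simp add: ord_ge_def)

lemma ord_ge_imp_dist_fls:
  fixes f g :: "'a::group_add fls"
  assumes "ord_ge (int n) (f - g)"
  shows "dist f g \<le> inverse (2 ^ n)"
proof (cases "f = g")
  case False
  with assms have n: "int n \<le> fls_subdegree (f - g)" by (simp add: ord_ge_iff)
  with False have "dist f g = inverse (2 ^ nat (fls_subdegree (f - g)))"
    by (simp add: dist_fls_def)
  also have "\<dots> \<le> inverse (2 ^ n)" using n by (simp add: power_increasing)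
  finally show ?thesis .
qed simp

lemma open_ord_ge:
  fixes a :: "'a::group_add fls"
  shows "open {z. ord_ge n (z - a)}"
  unfolding open_fls_def
proof (intro ballI exI conjI subsetI)
  fix y z assume "y \<in> {z. ord_ge n (z - a)}" "z \<in> {z. dist z y < inverse (2 ^ nat n)}"
  then have "ord_ge n (y - a)" and zy: "ord_ge (int (nat n)) (z - y)"
    by (auto intro: dist_fls_imp_ord_ge simp del: int_nat_eq)
  moreover from zy have "ord_ge n (z - y)" by (rule ord_ge_mono) simp
  ultimately have "ord_ge n ((z - y) + (y - a))" by (intro ord_ge_add)
  then show "z \<in> {z. ord_ge n (z - a)}" by (simp add: add_diff_eq)
qed auto

lemma open_fls_subdegree_eq:
  "open {z :: 'a::field fls. z \<noteq> 0 \<and> fls_subdegree z = n}"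
proof (subst open_subopen, rule ballI)
  fix a :: "'a fls" assume a: "a \<in> {z. z \<noteq> 0 \<and> fls_subdegree z = n}"
  let ?T = "{z. ord_ge (n + 1) (z - a)}"
  have "z \<noteq> 0 \<and> fls_subdegree z = n" if "z \<in> ?T" for z
  proof (cases "z = a")
    case False
    then have sub: "n < fls_subdegree (z - a)" using that by (simp add: ord_ge_iff)
    then have "fls_subdegree (a + (z - a)) = fls_subdegree a"
      using a by (intro fls_subdegree_add_eq1) auto
    moreover have "z \<noteq> 0" using sub a by auto
    ultimately show ?thesis using a by simp
  qed (use a in auto)
  then show "\<exists>T. open T \<and> a \<in> T \<and> T \<subseteq> {z. z \<noteq> 0 \<and> fls_subdegree z = n}"
    by (intro exI[of _ ?T]) (auto simp: open_ord_ge)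
qed

lemma compact_fls_integers: "compact {z :: 'a::{finite, group_add} fls. ord_ge 0 z}"
proof -
  let ?X = "product_topology (\<lambda>_. discrete_topology (UNIV :: 'a set)) (UNIV :: nat set)"
  let ?F = "\<lambda>c. fps_to_fls (Abs_fps c) :: 'a fls"
  have nth: "fls_nth (?F c) n = (if n < 0 then 0 else c (nat n))" for c n by simp
  have "continuous_map ?X euclidean ?F"
    unfolding continuous_map_def
  proof (intro conjI allI impI)
    fix U :: "'a fls set" assume "openin euclidean U"
    then have U: "open U" by simp
    show "openin ?X {c \<in> topspace ?X. ?F c \<in> U}"
    proof (subst openin_subopen, intro ballI)
      fix c assume "c \<in> {c \<in> topspace ?X. ?F c \<in> U}"
      then obtain r where r: "r > 0" "{y. dist y (?F c) < r} \<subseteq> U"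
        using U unfolding open_fls_def by blast
      obtain N where N: "inverse (2 ^ N) < r"
        using reals_power_lt_ex[OF r(1), of 2] by (auto simp: inverse_eq_divide power_one_over)
      define T where "T = PiE UNIV (\<lambda>i. if i < N then {c i} else UNIV)"
      have "openin ?X T"
        unfolding T_def
      proof (rule product_topology_basis)
        have "{i. (if i < N then {c i} else UNIV) \<noteq> topspace (discrete_topology UNIV)} \<subseteq> {..<N}"
          by auto
        then show "finite {i. (if i < N then {c i} else UNIV) \<noteq> topspace (discrete_topology UNIV)}"
          using finite_subset by blast
      qed auto
      moreover have "c \<in> T" by (auto simp: T_def)
      moreover have "?F d \<in> U" if "d \<in> T" for d
      proof -
        have "d i = c i" if "i < N" for i
          using \<open>d \<in> T\<close> that unfolding T_def PiE_UNIV_domain Pi_def by (auto split: if_splits)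
        then have "ord_ge (int N) (?F d - ?F c)"
          by (auto simp: ord_ge_def)
        then have "dist (?F d) (?F c) < r" using ord_ge_imp_dist_fls N by force
        then show ?thesis using r(2) by auto
      qed
      ultimately show "\<exists>T. openin ?X T \<and> c \<in> T \<and> T \<subseteq> {c \<in> topspace ?X. ?F c \<in> U}"
        by (intro exI[of _ T]) auto
    qed
  qed auto
  moreover have "compact_space ?X"
    by (simp add: compact_space_product_topology compact_space_discrete_topology)
  then have "compactin ?X (topspace ?X)"
    by (simp only: compact_space_def)
  ultimately have "compactin euclidean (?F ` topspace ?X)"
    by (rule image_compactin[rotated])
  moreover have "?F ` topspace ?X = {z. ord_ge 0 z}"
  proof (intro subset_antisym subsetI)
    fix z :: "'a fls" assume "z \<in> {z. ord_ge 0 z}"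
    then have "z = ?F (\<lambda>n. fls_nth z (int n))"
      by (intro fls_eqI) (auto simp: ord_ge_def)
    then show "z \<in> ?F ` topspace ?X" by auto
  qed (auto simp: ord_ge_def)
  ultimately show ?thesis by simp
qed

lemma compact_fls_units: "compact {z :: 'a::{field, finite} fls. z \<noteq> 0 \<and> fls_subdegree z = 0}"
proof -
  have "{z :: 'a fls. z \<noteq> 0 \<and> fls_subdegree z = 0} = {z. ord_ge 0 z} - {z. ord_ge 1 (z - 0)}"
    by (auto simp: ord_ge_iff)
  then show ?thesis using compact_fls_integers open_ord_ge by (metis compact_diff)
qed

lemma compact_vec_3:
  fixes S :: "'a::topological_space set"
  assumes "compact S"
  shows "compact {v :: 'a ^ 3. \<forall>k. v $ k \<in> S}"
proof -
  let ?F = "\<lambda>p. (\<chi> k. if k = 1 then fst p else if k = 2 then fst (snd p) else snd (snd p)) :: 'a ^ 3"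
  have "continuous_on UNIV ?F"
  proof (rule continuous_on_vec_lambda)
    fix k :: 3
    show "continuous_on UNIV (\<lambda>p::'a \<times> 'a \<times> 'a. if k = 1 then fst p else if k = 2 then fst (snd p) else snd (snd p))"
      using exhaust_3[of k] by (auto intro!: continuous_intros)
  qed
  then have "compact (?F ` (S \<times> S \<times> S))"
    by (intro compact_continuous_image compact_Times assms) (rule continuous_on_subset, auto)
  moreover have "?F ` (S \<times> S \<times> S) = {v. \<forall>k. v $ k \<in> S}"
  proof (intro subset_antisym subsetI)
    fix v :: "'a ^ 3" assume "v \<in> {v. \<forall>k. v $ k \<in> S}"
    moreover have "v = ?F (v $ 1, v $ 2, v $ 3)"
      using exhaust_3 by (auto simp: vec_eq_iff)
    ultimately show "v \<in> ?F ` (S \<times> S \<times> S)" by blast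
  qed auto
  ultimately show ?thesis by simp
qed

lemma continuous_diagonal_matrix:
  "continuous_on S (diagonal_matrix :: 'a::{zero, topological_space} ^ 'n \<Rightarrow> _)"
  unfolding diagonal_matrix_def
proof (intro continuous_on_vec_lambda)
  fix i j :: 'n
  show "continuous_on S (\<lambda>v :: 'a ^ 'n. if i = j then v $ i else 0)"
    by (cases "i = j") (auto intro!: continuous_intros)
qed

lemma compact_box: "compact (box :: ('a::{field, finite} fls ^ 3) set)"
  using compact_vec_3[OF compact_fls_integers] by (simp add: box_def)

lemma compact_unit_box: "compact (unit_box :: ('a::{field, finite} fls ^ 3) set)"
  using compact_vec_3[OF compact_fls_units] by (simp add: unit_box_def)

lemma Lambda_SOL_discrete:
  "subtopology (SOL_topology fls_abs) Lambda_SOL = discrete_topology (Lambda_SOL :: 'p::prime_card SOL_elt set)"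
proof (rule subtopology_eq_discrete_topology, intro conjI)
  show sub: "Lambda_SOL \<subseteq> topspace (SOL_topology fls_abs :: 'p SOL_elt topology)"
    using subgroup.subset[OF subgroup_Lambda_SOL] by (simp add: SOL_topology_def)
  have "h \<notin> SOL_topology fls_abs derived_set_of Lambda_SOL" if h: "h \<in> Lambda_SOL" for h :: "'p SOL_elt"
  proof -
    obtain f i j where hf: "h = sol f i j" using Lambda_SOL_form[OF h] by blast
    define A where "A = (\<Inter>k. (\<lambda>v. v $ k) -` {z. ord_ge 1 (z - f $ k)})"
    define B where "B = (\<Inter>k. (\<lambda>M. M $ k) -` ((\<lambda>v. v $ k) -`
      {z :: 'p mod_ring fls. z \<noteq> 0 \<and> fls_subdegree z = fls_subdegree ((tor i j :: 'p mod_ring fls ^ 3) $ k)}))"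
    have "open (A \<times> B)"
      unfolding A_def B_def
      by (intro open_Times open_INT finite ballI open_vimage_vec_nth open_ord_ge open_fls_subdegree_eq)
    then have "openin (SOL_topology fls_abs) (carrier SOL3 \<inter> A \<times> B)"
      by (simp add: SOL_topology_def openin_open_Int)
    moreover have "h \<in> carrier SOL3 \<inter> A \<times> B"
      by (auto simp: hf A_def B_def) (simp_all add: sol_def)
    moreover have "y = h" if y: "y \<in> Lambda_SOL" "y \<in> A \<times> B" for y
    proof -
      obtain g k l where yg: "y = sol g k l" using Lambda_SOL_form[OF y(1)] by blast
      have "\<forall>n. fls_subdegree ((tor k l :: 'p mod_ring fls ^ 3) $ n) =
          fls_subdegree ((tor i j :: 'p mod_ring fls ^ 3) $ n)"
        using y(2) by (simp add: yg sol_def B_def)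
      from this[rule_format, of 1] this[rule_format, of 2] have kl: "k = i" "l = j" by simp_all
      have "y \<otimes>\<^bsub>SOL3\<^esub> inv\<^bsub>SOL3\<^esub> h \<in> Lambda_SOL"
        using subgroup.m_closed[OF subgroup_Lambda_SOL] subgroup.m_inv_closed[OF subgroup_Lambda_SOL] y(1) h
        by blast
      moreover have "y \<otimes>\<^bsub>SOL3\<^esub> inv\<^bsub>SOL3\<^esub> h = sol (g - f) 0 0"
        by (simp add: hf yg kl tor_mult flip: mult.assoc)
      moreover have "ord_ge 1 ((g - f) $ n)" for n
        using y(2) by (simp add: yg sol_def A_def)
      ultimately have "g - f = 0"
        by (intro Lambda_SOL_small) (auto intro: ord_ge_mono[of 1])
      then show ?thesis by (simp add: hf yg kl)
    qed
    ultimately show ?thesis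
      unfolding in_derived_set_of by (metis IntD2)
  qed
  then show "Lambda_SOL \<inter> SOL_topology fls_abs derived_set_of (Lambda_SOL :: 'p SOL_elt set) = {}"
    by blast
qed

lemma cocompact_lattice_Lambda_SOL:
  "cocompact_lattice SOL3 (SOL_topology fls_abs) (Lambda_SOL :: 'p::prime_card SOL_elt set)"
  unfolding cocompact_lattice_def
proof (intro conjI subgroup_Lambda_SOL Lambda_SOL_discrete)
  let ?G = "SOL3 :: 'p SOL_elt monoid" and ?X = "SOL_topology fls_abs :: 'p SOL_elt topology"
  let ?q = "\<lambda>g. g <#\<^bsub>?G\<^esub> Lambda_SOL" and ?K = "box \<times> diagonal_matrix ` unit_box :: 'p SOL_elt set"
  interpret G: group ?G by (rule group_SOL)
  have X: "topspace ?X = carrier ?G" by (simp add: SOL_topology_def)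
  have K: "?K \<subseteq> carrier ?G"
    by (auto simp: SOL_def diagonal_matrix_in_norm_one_diag unit_box_def)
  have "compactin ?X ?K"
    using K by (auto simp: SOL_topology_def compactin_subtopology intro!: compact_Times compact_box
        compact_continuous_image continuous_diagonal_matrix compact_unit_box)
  moreover have q: "quotient_map ?X (quotient_topology ?X ?q) ?q"
    by (rule quotient_map_quotient_topology)
  ultimately have "compactin (quotient_topology ?X ?q) (?q ` ?K)"
    by (rule image_compactin[OF _ quotient_imp_continuous_map])
  moreover have "?q ` ?K = topspace (quotient_topology ?X ?q)"
  proof -
    have "?q g \<in> ?q ` ?K" if g: "g \<in> carrier ?G" for g
    proof -
      obtain w c h where wch: "w \<in> box" "c \<in> unit_box" "h \<in> Lambda_SOL"
        "g = (w, diagonal_matrix c) \<otimes>\<^bsub>?G\<^esub> h"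
        using SOL_decomposition[OF g] by blast
      have mem: "(w, diagonal_matrix c) \<in> ?K" using wch by blast
      then have "(w, diagonal_matrix c) \<in> carrier ?G" using K by blast
      then have "g \<in> (w, diagonal_matrix c) <#\<^bsub>?G\<^esub> Lambda_SOL"
        using wch by (auto simp: l_coset_def)
      then have "?q (w, diagonal_matrix c) = ?q g"
        using G.l_repr_independence[OF _ _ subgroup_Lambda_SOL] \<open>(w, diagonal_matrix c) \<in> carrier ?G\<close>
        by blast
      then show ?thesis using mem by (metis image_eqI)
    qed
    then have "?q ` carrier ?G = ?q ` ?K" using K by blast
    then show ?thesis using quotient_imp_surjective_map[OF q] X by simp
  qed
  ultimately show "compact_space (quotient_topology ?X ?q)"
    by (simp add: compact_space_def)
qed

theorem proposition3p4:
  fixes p :: nat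
  assumes "prime p" and "CARD('p::prime_card) = p"
  shows "\<exists>H. cocompact_lattice
               (SOL fls_abs :: (('p mod_ring fls ^ 3) \<times> ('p mod_ring fls ^ 3 ^ 3)) monoid)
               (SOL_topology fls_abs) H \<and>
             Lambda p \<cong> (SOL fls_abs)\<lparr>carrier := H\<rparr>"
  using cocompact_lattice_Lambda_SOL[where 'p = 'p] Lambda_iso_Lambda_SOL[where 'p = 'p] assms(2) by blast

end
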